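(* Let $p$ be a prime and let $f(z) \in \overline{\mathbb{F}}_p[z]$ be an additive, separable polynomial. Then $f$ does not admit a geometric $\mathrm{IMG}$-lift over any characteristic zero discrete valuation ring $R$ with residue field $\overline{\mathbb{F}}_p$; that is, there is no lift of $f$ over such an $R$ which preserves the geometric iterated monodromy action.
   Context: A polynomial $f \in \overline{\mathbb{F}}_p[z]$ is additive if $f(x+y)=f(x)+f(y)$, equivalently $f(z)=\sum_{i=0}^m a_i z^{p^i}$; it is separable iff $a_0\neq 0$. For a field $F$ and $g \in F(z)$ with $g' \neq 0$, let $T$ be transcendental over $F$; for $n\ge1$ let $K_n$ be the splitting field of $g^n(z)-T$ over $\overline{F}(T)$ ($g^n$ the $n$-th iterate), and $K_\infty=\bigcup_n K_n$. The geometric iterated monodromy group is $\mathrm{IMG}_{\overline{F}}(g) = \mathrm{Gal}(K_\infty/\overline{F}(T))$, which acts on the backward orbit $\mathcal{O}_g^-(T) = \bigcup_{n\geq 1} g^{-n}(T)$ (the roots of all $g^n(z)-T$). Let $R$ be a characteristic zero DVR with residue field $k=\overline{\mathbb{F}}_p$ and fraction field $K$, with coordinates $t$ on $\mathbb{P}^1_k$ and $T$ on $\mathbb{P}^1_K$. A geometric $\mathrm{IMG}$-lift of $f$ over $R$ is a rational map $\tilde{f}(z) \in R(z)$ such that (1) the special fiber $\tilde{f}\times_R k$ (reduction of $\tilde f$ modulo the maximal ideal of $R$) is isomorphic to $f$ as a dynamical system (i.e. linearly conjugate to $f$ by an element of $\mathrm{PGL}_2$); and (2) the specialization map $\mathcal{O}_{\tilde{f}}^-(T)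 \to \mathcal{O}_f^-(t)$ induces an equivalence between the action of $\mathrm{IMG}_{\overline{K}}(\tilde{f})$ on $\mathcal{O}_{\tilde{f}}^-(T)$ and the action of $\mathrm{IMG}_{\overline{k}}(f)$ on $\mathcal{O}_f^-(t)$. Actions of $G$ on $\Omega$ and $G'$ on $\Omega'$ are equivalent if there are a group isomorphism $\phi: G\to G'$ and a bijection $\beta:\Omega\to\Omega'$ with $\beta(g\ast\omega)=\phi(g)\ast\beta(\omega)$ for all $g,\omega$.
   Formalization: The polynomial f is assumed to have degree at least 2; without this the claim fails, since f(z)=z (and likewise every f(z)=az, via the Teichmüller lift of a over the Witt vectors) does admit a geometric IMG-lift. *)

theory Defs
  imports "HOL-Algebra.Algebra" "HOL-Algebra.Algebraic_Closure_Type"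
begin

section \<open>Rational functions\<close>

text \<open>
  The field of rational functions over a field of type 'a is the type 'a poly fract.
\<close>

definition frac_of :: "'a::idom \<Rightarrow> 'a fract" where
  "frac_of a = Fraction_Field.Fract a 1"

definition lowest_terms :: "'a::field poly fract \<Rightarrow> 'a poly \<times> 'a poly" where
  "lowest_terms g = (SOME (P, Q). Q \<noteq> 0 \<and> coprime P Q \<and> g = Fraction_Field.Fract P Q)"

text \<open>
  Evaluation at a point of an extension field, given by the embedding \<open>h\<close>. It is meaningful
  only where the denominator does not vanish; this is automatic at points that are transcendental
  over the constants.
\<close>
definition rat_eval :: "('a::field \<Rightarrow> 'b::field) \<Rightarrow> 'a poly fract \<Rightarrow> 'b \<Rightarrow> 'b" where
  "rat_eval h g x =
     (case lowest_terms g of (P, Q) \<Rightarrow> poly (map_poly h P) x / poly (map_poly h Q) x)"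

text \<open>Composition \<open>g1 \<circ> g2\<close>, for non-constant \<open>g2\<close>.\<close>
definition rat_comp :: "'a::field poly fract \<Rightarrow> 'a poly fract \<Rightarrow> 'a poly fract" where
  "rat_comp g1 g2 = rat_eval (\<lambda>c. frac_of [:c:]) g1 g2"

definition rat_iter :: "nat \<Rightarrow> 'a::field poly fract \<Rightarrow> 'a poly fract" where
  "rat_iter n g = (rat_comp g ^^ n) (frac_of [:0, 1:])"


section \<open>Geometric iterated monodromy groups\<close>

text \<open>
  For a field \<open>F\<close> of type 'f, everything takes place in a fixed algebraic closure of the
  rational function field in one variable \<open>T\<close> over the algebraic closure of \<open>F\<close>.
\<close>
type_synonym 'f geom = "'f alg_closure poly fract alg_closure"

definition geom_const :: "'f::field \<Rightarrow> 'f geom" where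
  "geom_const c = to_ac (frac_of [:to_ac c:])"

definition geom_T :: "'f::field geom" where
  "geom_T = to_ac (frac_of [:0, 1:])"

definition geom_base :: "'f::field geom set" where
  "geom_base = range to_ac"

text \<open>\<open>g\<^sup>-\<^sup>n(T)\<close>, the roots of the numerator \<open>P - T Q\<close> of \<open>g\<^sup>n(z) - T\<close>, where \<open>g\<^sup>n = P / Q\<close>.\<close>
definition preimages_T :: "nat \<Rightarrow> 'f::field poly fract \<Rightarrow> 'f geom set" where
  "preimages_T n g =
     (case lowest_terms (rat_iter n g) of (P, Q) \<Rightarrow>
        {x. poly (map_poly geom_const P - smult geom_T (map_poly geom_const Q)) x = 0})"

definition backward_orbit :: "'f::field poly fract \<Rightarrow> 'f geom set" where
  "backward_orbit g = (\<Union>n\<in>{1..}. preimages_T n g)"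

definition splitting_K :: "nat \<Rightarrow> 'f::field poly fract \<Rightarrow> 'f geom set" where
  "splitting_K n g = generate_field ring_of_type_algebra (geom_base \<union> preimages_T n g)"

definition K_infinity :: "'f::field poly fract \<Rightarrow> 'f geom set" where
  "K_infinity g = (\<Union>n\<in>{1..}. splitting_K n g)"

text \<open>Gal(L/F) for subfields \<open>F \<subseteq> L\<close> of an ambient field; automorphisms are extensional on \<open>L\<close>.\<close>
definition Galois_group :: "'a::field set \<Rightarrow> 'a set \<Rightarrow> ('a \<Rightarrow> 'a) monoid" where
  "Galois_group L F = (BijGroup L)\<lparr>carrier :=
     {\<sigma> \<in> Bij L. \<sigma> \<in> ring_hom (ring_of_type_algebra\<lparr>carrier := L\<rparr>) (ring_of_type_algebra\<lparr>carrier := L\<rparr>)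
                 \<and> (\<forall>x\<in>F. \<sigma> x = x)}\<rparr>"

definition geom_IMG :: "'f::field poly fract \<Rightarrow> ('f geom \<Rightarrow> 'f geom) monoid" where
  "geom_IMG g = Galois_group (K_infinity g) geom_base"

definition equivalent_actions_via ::
  "('a \<Rightarrow> 'b) \<Rightarrow> ('g, 'm) monoid_scheme \<Rightarrow> ('g \<Rightarrow> 'a \<Rightarrow> 'a) \<Rightarrow> 'a set
    \<Rightarrow> ('h, 'n) monoid_scheme \<Rightarrow> ('h \<Rightarrow> 'b \<Rightarrow> 'b) \<Rightarrow> 'b set \<Rightarrow> bool" where
  "equivalent_actions_via \<beta> G act \<Omega> G' act' \<Omega>' \<longleftrightarrow>
     bij_betw \<beta> \<Omega> \<Omega>' \<and>
     (\<exists>\<phi>\<in>iso G G'. \<forall>g\<in>carrier G. \<forall>\<omega>\<in>\<Omega>. \<beta> (act g \<omega>) = act' (\<phi> g) (\<beta> \<omega>))"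


section \<open>Discrete valuation rings and residue fields\<close>

definition discrete_valuation_ring :: "('a, 'b) ring_scheme \<Rightarrow> bool" where
  "discrete_valuation_ring R \<longleftrightarrow>
     principal_domain R \<and> \<not> field R \<and> (\<exists>!I. maximalideal I R)"

text \<open>
  For a local ring \<open>R\<close> the kernel of a surjective homomorphism onto a field is the maximal
  ideal, so such a map is the same as an identification of the residue field of \<open>R\<close> with \<open>k\<close>.
\<close>
definition residue_map :: "('r::idom \<Rightarrow> 'k::field) \<Rightarrow> bool" where
  "residue_map red \<longleftrightarrow> red \<in> ring_hom ring_of_type_algebra ring_of_type_algebra \<and> surj red"

text \<open>The prime subfield of a field of characteristic \<open>p\<close> is \<open>range of_nat\<close>.\<close>
definition is_alg_closure_of_Fp :: "nat \<Rightarrow> 'k::field itself \<Rightarrow> bool" where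
  "is_alg_closure_of_Fp p _ \<longleftrightarrow>
     CHAR('k) = p \<and> algebraic_closure (ring_of_type_algebra :: 'k ring) (range of_nat)"


section \<open>Reduction and specialization\<close>

text \<open>
  Since \<open>R(z) = K(z)\<close>, rational maps over \<open>R\<close> are elements of \<open>K(z)\<close>. The reduction is computed from
  a representation with coefficients in \<open>R\<close>, not both of whose parts reduce to zero. Reductions
  that are constantly \<open>\<infinity>\<close> are left out. Common factors of the reduced numerator and denominator
  are allowed, so that good reduction is not presupposed.
\<close>
definition reduces_to ::
  "('r::idom \<Rightarrow> 'k::field) \<Rightarrow> 'r fract poly fract \<Rightarrow> 'k poly fract \<Rightarrow> bool" where
  "reduces_to red g g0 \<longleftrightarrow>
     (\<exists>P Q. g = Fraction_Field.Fract (map_poly frac_of P) (map_poly frac_of Q) \<and>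
            map_poly red Q \<noteq> 0 \<and>
            g0 = Fraction_Field.Fract (map_poly red P) (map_poly red Q))"

text \<open>The Moebius transformation \<open>(a z + b) / (c z + d)\<close> as a rational function and as a map on the
  projective line, whose point at infinity is \<open>None\<close>.\<close>
definition moebius_rat :: "'k::field \<Rightarrow> 'k \<Rightarrow> 'k \<Rightarrow> 'k \<Rightarrow> 'k poly fract" where
  "moebius_rat a b c d = Fraction_Field.Fract [:b, a:] [:d, c:]"

fun moebius :: "'l::field \<Rightarrow> 'l \<Rightarrow> 'l \<Rightarrow> 'l \<Rightarrow> 'l option \<Rightarrow> 'l option" where
  "moebius a b c d (Some x) = (if c * x + d = 0 then None else Some ((a * x + b) / (c * x + d)))"
| "moebius a b c d None = (if c = 0 then None else Some (a / c))"

text \<open>A place in the classical sense: a homomorphism on a valuation ring into a field, with value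
  \<open>\<infinity>\<close> (that is, \<open>None\<close>) outside of it.\<close>
definition is_place :: "('l::field \<Rightarrow> 'm::field option) \<Rightarrow> bool" where
  "is_place \<pi> \<longleftrightarrow>
     \<pi> 1 = Some 1 \<and>
     (\<forall>x y u v. \<pi> x = Some u \<longrightarrow> \<pi> y = Some v \<longrightarrow>
        \<pi> (x + y) = Some (u + v) \<and> \<pi> (x * y) = Some (u * v)) \<and>
     (\<forall>x. \<pi> x = None \<longrightarrow> \<pi> (inverse x) = Some 0)"

text \<open>
  A lift \<open>g\<close> of \<open>f\<close>, for a given residue map \<open>red : R \<rightarrow> k\<close>. The Moebius transformation \<open>\<mu>\<close> conjugates
  the reduction \<open>g0\<close> of \<open>g\<close> to \<open>f\<close>. Specialization from the generic to the special fibre is a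
  place \<open>\<pi>\<close> extending \<open>red\<close>, followed by \<open>\<mu>\<close>, with the coordinates matched so that \<open>T\<close> specializes
  to \<open>t\<close>. As \<open>t\<close> is transcendental over \<open>k\<close>, on \<open>K(T)\<close> this is reduction at the generic point of the
  special fibre of the projective line over \<open>R\<close>. Such places differ only by automorphisms over
  \<open>K(T)\<close> and \<open>k(t)\<close>, which preserve the two geometric actions up to equivalence, so it does
  not matter which one is used.
\<close>
definition geometric_IMG_lift ::
  "('r::idom \<Rightarrow> 'k::field) \<Rightarrow> 'k poly fract \<Rightarrow> 'r fract poly fract \<Rightarrow> bool" where
  "geometric_IMG_lift red f g \<longleftrightarrow>
     (\<exists>a b c d g0.
        a * d - b * c \<noteq> 0 \<and>
        reduces_to red g g0 \<and>
        rat_comp (moebius_rat a b c d) g0 = rat_comp f (moebius_rat a b c d) \<and>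
        (\<exists>(\<pi> :: 'r fract geom \<Rightarrow> 'k geom option) \<beta>.
           let sp = (\<lambda>x. moebius (geom_const a) (geom_const b) (geom_const c) (geom_const d) (\<pi> x)) in
           is_place \<pi> \<and>
           (\<forall>r. \<pi> (geom_const (frac_of r)) = Some (geom_const (red r))) \<and>
           sp geom_T = Some geom_T \<and>
           (\<forall>\<omega>\<in>backward_orbit g. sp \<omega> = Some (\<beta> \<omega>)) \<and>
           equivalent_actions_via \<beta>
             (geom_IMG g) (\<lambda>\<sigma> \<omega>. \<sigma> \<omega>) (backward_orbit g)
             (geom_IMG f) (\<lambda>\<sigma> \<omega>. \<sigma> \<omega>) (backward_orbit f)))"


section \<open>Additive polynomials\<close>

text \<open>Over an infinite field, this is equivalent to the identity of polynomials in two variables.\<close>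
definition additive_poly :: "'k::comm_ring_1 poly \<Rightarrow> bool" where
  "additive_poly f \<longleftrightarrow> (\<forall>x y. poly f (x + y) = poly f x + poly f y)"

text \<open>
  Over an algebraically closed field, the separable polynomials are those without repeated roots,
  that is, those satisfying \<open>rsquarefree\<close>. Such an additive polynomial of degree one is linear, and
  then a lift exists: the identity lifts the identity. So dynamical systems are understood to have
  degree at least two.
\<close>

end

(* Only the equivalence of the two actions matters. On the side of the additive polynomial, every
   automorphism translates a point of the backward orbit by a constant, so the action is commutative
   of exponent p, and its orbits on the fibres over T are arbitrarily large, because the kernels of
   the iterates grow. In characteristic zero let x lie in the backward orbit of a lift. As the action
   is commutative, the Galois correspondence puts the conjugates of x into C(x), C the algebraically
   closed constant field, so they are Moebius transforms of x. Commuting Moebius transformations of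
   exponent p in characteristic zero are, in a suitable coordinate u, of the form u -> k u or
   u -> m / u with k^p = 1 and m^p fixed, so x has at most 2 p conjugates. *)

theory Submission
  imports Defs
begin

hide_const (open) UnivPoly.coeff UnivPoly.monom Polynomials.degree Polynomials.lead_coeff Module.smult

section \<open>Extension of partial isomorphisms\<close>

text \<open>No finite Galois theory is used. Automorphisms of the whole algebraic closure of C(T)
  are built by Zorn's lemma and restricted to \<open>K_infinity\<close>; this gives transitivity on
  fibres and the one instance of the Galois correspondence that is required. The obstacle is the
  passage from C(x) to Moebius transformations: a conjugate y is a rational function r of x, by
  transitivity x is also a rational function of y, so r is injective on the constants where it is
  defined, and in characteristic zero this forces degree one. Characteristic zero enters twice more:
  it makes minimal polynomials separable, and it denies finite order to the translations u -> u + b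
  with nonzero b, the very maps of which the additive side consists. Inversions u -> m / u can have
  exponent p only for p = 2, where together with u -> -u they form a Klein four-group; treating all
  p alike costs the factor 2 in the bound 2 p. On the additive side, separability and degree at
  least two yield a nonzero root of f, and its iterated preimages make the kernels grow.\<close>

definition subfield_set :: "'a::field set \<Rightarrow> bool" where
  "subfield_set S \<longleftrightarrow> 1 \<in> S \<and> (\<forall>x\<in>S. - x \<in> S \<and> inverse x \<in> S)
     \<and> (\<forall>x\<in>S. \<forall>y\<in>S. x + y \<in> S \<and> x * y \<in> S)"

lemma subfield_setD:
  assumes "subfield_set S"
  shows "1 \<in> S" "0 \<in> S"
    "x \<in> S \<Longrightarrow> - x \<in> S" "x \<in> S \<Longrightarrow> inverse x \<in> S"
    "x \<in> S \<Longrightarrow> y \<in> S \<Longrightarrow> x + y \<in> S" "x \<in> S \<Longrightarrow> y \<in> S \<Longrightarrow> x * y \<in> S"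
    "x \<in> S \<Longrightarrow> y \<in> S \<Longrightarrow> x - y \<in> S" "x \<in> S \<Longrightarrow> y \<in> S \<Longrightarrow> x / y \<in> S"
proof -
  have 1: "1 \<in> S" and neg: "\<And>x. x \<in> S \<Longrightarrow> - x \<in> S" and inv: "\<And>x. x \<in> S \<Longrightarrow> inverse x \<in> S"
    and add: "\<And>x y. x \<in> S \<Longrightarrow> y \<in> S \<Longrightarrow> x + y \<in> S" and mult: "\<And>x y. x \<in> S \<Longrightarrow> y \<in> S \<Longrightarrow> x * y \<in> S"
    using assms by (auto simp: subfield_set_def)
  show "1 \<in> S" "x \<in> S \<Longrightarrow> - x \<in> S" "x \<in> S \<Longrightarrow> inverse x \<in> S"
    "x \<in> S \<Longrightarrow> y \<in> S \<Longrightarrow> x + y \<in> S" "x \<in> S \<Longrightarrow> y \<in> S \<Longrightarrow> x * y \<in> S"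
    by (fact 1 neg inv add mult)+
  show "0 \<in> S"
    using add[OF 1 neg[OF 1]] by simp
  show "x \<in> S \<Longrightarrow> y \<in> S \<Longrightarrow> x - y \<in> S"
    using add neg by (metis add_uminus_conv_diff)
  show "x \<in> S \<Longrightarrow> y \<in> S \<Longrightarrow> x / y \<in> S"
    using mult inv by (metis divide_inverse)
qed

lemma poly_in_subfield_set:
  assumes "subfield_set S" "\<And>i. coeff p i \<in> S" "x \<in> S"
  shows "poly p x \<in> S"
  using assms(2)
proof (induction p)
  case (pCons a p)
  have "a \<in> S" "\<And>i. coeff p i \<in> S"
    using pCons.prems[of 0] pCons.prems[of "Suc _"] by auto
  with pCons.IH assms(3) show ?case
    by (simp add: subfield_setD(5,6)[OF assms(1)])
qed (simp add: subfield_setD(2)[OF assms(1)])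

text \<open>A partial isomorphism over \<open>F\<close> is encoded by its graph, a subring of the product ring.\<close>
definition iso_graph :: "'a::field set \<Rightarrow> ('a \<times> 'a) set \<Rightarrow> bool" where
  "iso_graph F R \<longleftrightarrow> (\<forall>c\<in>F. (c, c) \<in> R)
     \<and> (\<forall>u v u' v'. (u, v) \<in> R \<longrightarrow> (u', v') \<in> R \<longrightarrow> (u + u', v + v') \<in> R \<and> (u * u', v * v') \<in> R)
     \<and> (\<forall>v. (0, v) \<in> R \<longrightarrow> v = 0)"

text \<open>A pair is a polynomial over the domain of the partial isomorphism together with its
  image, so that the map never has to be named as a function.\<close>

definition graph_polys :: "('a::field \<times> 'a) set \<Rightarrow> ('a poly \<times> 'a poly) set" where
  "graph_polys R = {(p, q). \<forall>i. (coeff p i, coeff q i) \<in> R}"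

text \<open>Every element is algebraic over \<open>F\<close>, so a subring containing
  \<open>F\<close> is automatically a field; closure of \<open>R\<close> under inverses is derived
  from this.\<close>

locale partial_iso =
  fixes F :: "'a::field set" and R :: "('a \<times> 'a) set"
  assumes F: "subfield_set F"
    and alg: "\<And>x. \<exists>p. p \<noteq> 0 \<and> (\<forall>i. coeff p i \<in> F) \<and> poly p x = 0"
    and R: "iso_graph F R"
begin

lemma diag: "c \<in> F \<Longrightarrow> (c, c) \<in> R"
  and add: "(u, v) \<in> R \<Longrightarrow> (u', v') \<in> R \<Longrightarrow> (u + u', v + v') \<in> R"
  and mult: "(u, v) \<in> R \<Longrightarrow> (u', v') \<in> R \<Longrightarrow> (u * u', v * v') \<in> R"
  and zero: "(0, v) \<in> R \<Longrightarrow> v = 0"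
  using R by (auto simp: iso_graph_def)

lemma zero_in [simp]: "(0, 0) \<in> R" and one_in [simp]: "(1, 1) \<in> R"
  using diag subfield_setD[OF F] by auto

lemma diff:
  assumes "(u, v) \<in> R" "(u', v') \<in> R"
  shows "(u - u', v - v') \<in> R"
  using add[OF assms(1) mult[OF diag[OF subfield_setD(3)[OF F subfield_setD(1)[OF F]]] assms(2)]]
  by simp

lemma unique: "(u, v) \<in> R \<Longrightarrow> (u, v') \<in> R \<Longrightarrow> v = v'"
  using diff[of u v u v'] zero by force

lemma eval:
  assumes "(p, q) \<in> graph_polys R" "(u, v) \<in> R"
  shows "(poly p u, poly q v) \<in> R"
  using assms(1)
proof (induction p arbitrary: q)
  case 0
  then have "q = 0"
    using zero by (auto simp: graph_polys_def poly_eq_iff)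
  then show ?case by simp
next
  case (pCons a p)
  obtain b q' where q: "q = pCons b q'"
    by (rule pCons_cases)
  have "(a, b) \<in> R"
    using pCons.prems coeff_pCons_0[of a p] coeff_pCons_0[of b q'] unfolding graph_polys_def q
    by (metis (mono_tags, lifting) case_prod_conv mem_Collect_eq)
  moreover have "(p, q') \<in> graph_polys R"
  proof -
    have "(coeff (pCons a p) (Suc i), coeff (pCons b q') (Suc i)) \<in> R" for i
      using pCons.prems by (simp add: graph_polys_def q del: coeff_pCons_Suc)
    then show ?thesis
      by (simp add: graph_polys_def)
  qed
  ultimately show ?case
    using pCons.IH assms(2) by (simp add: q add mult)
qed

text \<open>Factors X are stripped from an annihilating polynomial until its constant term a is
  nonzero; then a + x p(x) = 0 gives the inverse -p(x) / a.\<close>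

lemma inverse_in_polys: "x \<noteq> 0 \<Longrightarrow> \<exists>q. (\<forall>i. coeff q i \<in> F) \<and> x * poly q x = 1"
proof -
  assume x: "x \<noteq> 0"
  have "p \<noteq> 0 \<Longrightarrow> \<forall>i. coeff p i \<in> F \<Longrightarrow> poly p x = 0 \<Longrightarrow> ?thesis" for p
  proof (induction p)
    case (pCons a p)
    have a: "a \<in> F" and p: "\<forall>i. coeff p i \<in> F"
      using pCons.prems(2) by (metis coeff_pCons_0, metis coeff_pCons_Suc)
    show ?case
    proof (cases "a = 0")
      case True
      with pCons x p show ?thesis by auto
    next
      case False
      define q where "q = smult (- inverse a) p"
      have "\<forall>i. coeff q i \<in> F"
        using a p by (simp add: q_def subfield_setD(3,4,6)[OF F])
      moreover have "x * poly q x = 1"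
        using pCons.prems(3) False by (simp add: q_def field_simps add_eq_0_iff)
      ultimately show ?thesis by blast
    qed
  qed auto
  with alg[of x] show ?thesis by blast
qed

lemma inverse_in:
  assumes "(u, v) \<in> R" "u \<noteq> 0"
  shows "v \<noteq> 0" "(inverse u, inverse v) \<in> R"
proof -
  obtain q where q: "\<forall>i. coeff q i \<in> F" "u * poly q u = 1"
    using inverse_in_polys[OF assms(2)] by blast
  have qR: "(poly q u, poly q v) \<in> R"
    using q(1) by (intro eval assms(1)) (auto simp: graph_polys_def diag)
  from mult[OF assms(1) this] have "v * poly q v = 1"
    using unique[OF _ one_in] q(2) by auto
  then show "v \<noteq> 0" "(inverse u, inverse v) \<in> R"
    using qR q(2) by (auto simp: inverse_unique)
qed

lemma graph_polys_add: "(p, q) \<in> graph_polys R \<Longrightarrow> (p', q') \<in> graph_polys R \<Longrightarrow> (p + p', q + q') \<in> graph_polys R"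
  by (simp add: graph_polys_def add)

lemma graph_polys_diff: "(p, q) \<in> graph_polys R \<Longrightarrow> (p', q') \<in> graph_polys R \<Longrightarrow> (p - p', q - q') \<in> graph_polys R"
  by (simp add: graph_polys_def diff)

lemma sum_in:
  assumes "\<And>i. i \<in> A \<Longrightarrow> (f i, g i) \<in> R"
  shows "(sum f A, sum g A) \<in> R"
  using assms by (induction A rule: infinite_finite_induct) (simp_all add: add)

lemma graph_polys_mult: "(p, q) \<in> graph_polys R \<Longrightarrow> (p', q') \<in> graph_polys R \<Longrightarrow> (p * p', q * q') \<in> graph_polys R"
  by (simp add: graph_polys_def coeff_mult sum_in mult)

lemma graph_polys_const: "(u, v) \<in> R \<Longrightarrow> ([:u:], [:v:]) \<in> graph_polys R"
  by (auto simp: graph_polys_def coeff_pCons split: nat.split)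

lemma graph_polys_monom: "(u, v) \<in> R \<Longrightarrow> (monom u n, monom v n) \<in> graph_polys R"
  by (auto simp: graph_polys_def)

lemma graph_polys_zero: "(0, q) \<in> graph_polys R \<Longrightarrow> q = 0"
  using zero by (auto simp: graph_polys_def poly_eq_iff)

lemma graph_polys_degree:
  assumes "(p, q) \<in> graph_polys R"
  shows "degree q = degree p"
proof (cases "p = 0")
  case True
  then show ?thesis using graph_polys_zero[of q] assms by auto
next
  case False
  have "(lead_coeff p, coeff q (degree p)) \<in> R"
    using assms by (auto simp: graph_polys_def)
  then have "coeff q (degree p) \<noteq> 0"
    using inverse_in(1) False by auto
  moreover have "coeff q i = 0" if "i > degree p" for i
    using assms coeff_eq_0[OF that] zero by (auto simp: graph_polys_def dest: spec[of _ i])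
  ultimately show ?thesis
    by (meson le_antisym degree_le le_degree)
qed

text \<open>Up to a scalar, m is the minimal polynomial of z over the domain of \<open>R\<close>,
  and n is its image under the partial isomorphism.\<close>

definition minimal_pair :: "'a \<Rightarrow> 'a poly \<Rightarrow> 'a poly \<Rightarrow> bool" where
  "minimal_pair z m n \<longleftrightarrow> (m, n) \<in> graph_polys R \<and> m \<noteq> 0 \<and> poly m z = 0 \<and>
     (\<forall>(p, q)\<in>graph_polys R. p \<noteq> 0 \<longrightarrow> poly p z = 0 \<longrightarrow> degree m \<le> degree p)"

lemma minimal_pair_exists: "\<exists>m n. minimal_pair z m n"
proof -
  define P where "P = (\<lambda>x. x \<in> graph_polys R \<and> fst x \<noteq> 0 \<and> poly (fst x) z = 0)"
  obtain p where "p \<noteq> 0" "\<forall>i. coeff p i \<in> F" "poly p z = 0"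
    using alg by blast
  then have "P (p, p)"
    by (auto simp: P_def graph_polys_def diag)
  then have "\<exists>x. P x \<and> (\<forall>y. P y \<longrightarrow> degree (fst x) \<le> degree (fst y))"
    by (rule ex_has_least_nat)
  then obtain x where "P x" "\<And>y. P y \<Longrightarrow> degree (fst x) \<le> degree (fst y)"
    by blast
  then have "minimal_pair z (fst x) (snd x)"
    by (auto simp: minimal_pair_def P_def)
  then show ?thesis by blast
qed

lemma minimal_pair_degree:
  assumes "minimal_pair z m n"
  shows "degree m > 0"
proof (rule ccontr)
  assume "\<not> degree m > 0"
  then obtain a where "m = [:a:]"
    using degree_eq_zeroE by blast
  with assms show False
    unfolding minimal_pair_def by simp
qed

text \<open>Division by m is carried out on both coordinates at once, one leading term at a time. It
  follows that sending z to w is well defined on polynomial expressions: every relation satisfied by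
  z passes to w.\<close>

lemma minimal_pair_root:
  assumes m: "minimal_pair z m n" and w: "poly n w = 0"
    and "(p, q) \<in> graph_polys R" "poly p z = 0"
  shows "poly q w = 0"
  using assms(3,4)
proof (induction "degree p" arbitrary: p q rule: less_induct)
  case less
  show ?case
  proof (cases "p = 0")
    case True
    then show ?thesis using graph_polys_zero[of q] less.prems by auto
  next
    case False
    have mn: "(m, n) \<in> graph_polys R" "m \<noteq> 0" "poly m z = 0"
      using m by (auto simp: minimal_pair_def)
    have le: "degree m \<le> degree p"
      using m False less.prems by (auto simp: minimal_pair_def)
    define k where "k = degree p - degree m"
    have "(lead_coeff m, coeff n (degree m)) \<in> R" "(lead_coeff p, coeff q (degree p)) \<in> R"
      using mn less.prems by (auto simp: graph_polys_def)
    from mult[OF this(2) inverse_in(2)[OF this(1)]] mn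
    obtain c' where c: "(lead_coeff p / lead_coeff m, c') \<in> R"
      by (auto simp: divide_inverse)
    define p' where "p' = p - monom (lead_coeff p / lead_coeff m) k * m"
    define q' where "q' = q - monom c' k * n"
    have pq': "(p', q') \<in> graph_polys R"
      unfolding p'_def q'_def
      by (intro graph_polys_diff graph_polys_mult graph_polys_monom less.prems mn c)
    have z: "poly p' z = 0"
      using less.prems mn by (simp add: p'_def)
    have "degree p' \<le> degree p"
      unfolding p'_def using le
      by (intro degree_diff_le order.refl order.trans[OF degree_mult_le])
        (simp add: k_def, metis degree_monom_le add_le_mono1 le_add_diff_inverse2)
    moreover have "coeff p' (degree p) = 0"
      using le mn by (simp add: p'_def k_def coeff_monom_mult)
    ultimately have "p' = 0 \<or> degree p' < degree p"
      by (rule eq_zero_or_degree_less)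
    then have "poly q' w = 0"
      using less.hyps[OF _ pq' z] graph_polys_zero[of q'] pq' by auto
    then show ?thesis
      using w by (simp add: q'_def)
  qed
qed

text \<open>The extension of the partial isomorphism to the ring generated by z, with z sent to
  w.\<close>

definition adjoin :: "'a \<Rightarrow> 'a \<Rightarrow> ('a \<times> 'a) set" where
  "adjoin z w = {(poly p z, poly q w) | p q. (p, q) \<in> graph_polys R}"

lemma adjoin:
  assumes "minimal_pair z m n" "poly n w = 0"
  shows "iso_graph F (adjoin z w)" "R \<subseteq> adjoin z w" "(z, w) \<in> adjoin z w"
proof -
  show sub: "R \<subseteq> adjoin z w"
  proof
    fix x assume "x \<in> R"
    then have "([:fst x:], [:snd x:]) \<in> graph_polys R"
      by (intro graph_polys_const) auto
    then show "x \<in> adjoin z w"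
      unfolding adjoin_def by force
  qed
  have "(monom 1 1, monom 1 1) \<in> graph_polys R"
    by (intro graph_polys_monom) simp
  then show "(z, w) \<in> adjoin z w"
    unfolding adjoin_def by (force simp: poly_monom)
  show "iso_graph F (adjoin z w)"
    unfolding iso_graph_def
  proof (intro conjI allI impI ballI)
    show "(c, c) \<in> adjoin z w" if "c \<in> F" for c
      using that diag sub by blast
  next
    fix u v u' v' assume "(u, v) \<in> adjoin z w" "(u', v') \<in> adjoin z w"
    then obtain p q p' q' where *: "u = poly p z" "v = poly q w" "u' = poly p' z" "v' = poly q' w"
      and "(p, q) \<in> graph_polys R" "(p', q') \<in> graph_polys R"
      by (auto simp: adjoin_def)
    then have "(p + p', q + q') \<in> graph_polys R" "(p * p', q * q') \<in> graph_polys R"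
      by (auto intro: graph_polys_add graph_polys_mult)
    then show "(u + u', v + v') \<in> adjoin z w" "(u * u', v * v') \<in> adjoin z w"
      unfolding adjoin_def * poly_add[symmetric] poly_mult[symmetric] by blast+
  next
    fix v assume "(0, v) \<in> adjoin z w"
    then show "v = 0"
      using minimal_pair_root[OF assms] by (auto simp: adjoin_def) 
  qed
qed

end

definition field_automorphism :: "('a::field \<Rightarrow> 'a) \<Rightarrow> bool" where
  "field_automorphism \<sigma> \<longleftrightarrow> bij \<sigma> \<and> \<sigma> 1 = 1 \<and> (\<forall>x y. \<sigma> (x + y) = \<sigma> x + \<sigma> y \<and> \<sigma> (x * y) = \<sigma> x * \<sigma> y)"

text \<open>A maximal extension is total: an element z outside its domain could be adjoined, since
  the image of its minimal polynomial has a root in the algebraically closed field.\<close>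

theorem extend_partial_iso:
  fixes F :: "'a::alg_closed_field set"
  assumes "partial_iso F R"
  obtains \<sigma> where "field_automorphism \<sigma>" "\<And>u v. (u, v) \<in> R \<Longrightarrow> \<sigma> u = v"
proof -
  interpret R: partial_iso F R by fact
  define Ext where "Ext = {S. iso_graph F S \<and> R \<subseteq> S}"
  have "\<exists>M\<in>Ext. \<forall>S\<in>Ext. M \<subseteq> S \<longrightarrow> S = M"
  proof (rule subset_Zorn_nonempty)
    show "Ext \<noteq> {}"
      using R.R by (auto simp: Ext_def)
    fix Ch assume ne: "Ch \<noteq> {}" and chain: "subset.chain Ext Ch"
    have sub: "Ch \<subseteq> Ext" and lin: "\<And>S S'. S \<in> Ch \<Longrightarrow> S' \<in> Ch \<Longrightarrow> S \<subseteq> S' \<or> S' \<subseteq> S"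
      using chain by (auto simp: subset_chain_def)
    have graph: "iso_graph F S" if "S \<in> Ch" for S
      using that sub by (auto simp: Ext_def)
    have "iso_graph F (\<Union>Ch)"
      unfolding iso_graph_def
    proof (intro conjI allI impI ballI)
      show "(c, c) \<in> \<Union>Ch" if "c \<in> F" for c
      proof -
        obtain S where "S \<in> Ch" using ne by blast
        then show ?thesis
          using graph that unfolding iso_graph_def by blast
      qed
    next
      fix u v u' v' assume "(u, v) \<in> \<Union>Ch" "(u', v') \<in> \<Union>Ch"
      then obtain S S' where S: "S \<in> Ch" "(u, v) \<in> S" "S' \<in> Ch" "(u', v') \<in> S'"
        by blast
      then obtain S'' where "S'' \<in> Ch" "(u, v) \<in> S''" "(u', v') \<in> S''"
        using lin[of S S'] by blast
      moreover from this have "(u + u', v + v') \<in> S'' \<and> (u * u', v * v') \<in> S''"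
        using graph[of S''] unfolding iso_graph_def by blast
      ultimately show "(u + u', v + v') \<in> \<Union>Ch" "(u * u', v * v') \<in> \<Union>Ch"
        by blast+
    next
      show "v = 0" if "(0, v) \<in> \<Union>Ch" for v
        using that graph unfolding iso_graph_def by blast
    qed
    then show "\<Union>Ch \<in> Ext"
      using ne sub unfolding Ext_def by blast
  qed
  then obtain M where M: "iso_graph F M" "R \<subseteq> M"
    and max: "\<And>S. iso_graph F S \<Longrightarrow> M \<subseteq> S \<Longrightarrow> S = M"
    by (auto simp: Ext_def)
  interpret M: partial_iso F M
    using R.F R.alg M(1) by unfold_locales
  have total: "\<exists>w. (z, w) \<in> M" for z
  proof -
    obtain m n where mn: "M.minimal_pair z m n"
      using M.minimal_pair_exists by blast
    have "degree n > 0"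
      using M.minimal_pair_degree[OF mn] mn M.graph_polys_degree[of m n] by (simp add: M.minimal_pair_def)
    then obtain w where w: "poly n w = 0"
      using alg_closed_imp_poly_has_root by blast
    show ?thesis
      using max[OF M.adjoin(1,2)[OF mn w]] M.adjoin(3)[OF mn w] by auto
  qed
  define \<sigma> where "\<sigma> z = (SOME w. (z, w) \<in> M)" for z
  have \<sigma>: "(z, \<sigma> z) \<in> M" for z
    unfolding \<sigma>_def using total by (rule someI_ex)
  have \<sigma>_eq: "\<sigma> z = w" if "(z, w) \<in> M" for z w
    using M.unique[OF \<sigma> that] .
  have add: "\<sigma> (x + y) = \<sigma> x + \<sigma> y" and mult: "\<sigma> (x * y) = \<sigma> x * \<sigma> y"
    and diff: "\<sigma> (x - y) = \<sigma> x - \<sigma> y" for x y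
    using M.add M.mult M.diff \<sigma> by (auto intro!: \<sigma>_eq)
  have inj: "inj \<sigma>"
  proof (rule injI, rule ccontr)
    fix x y assume "\<sigma> x = \<sigma> y" "x \<noteq> y"
    then show False
      using M.inverse_in(1)[OF \<sigma>, of "x - y"] diff by auto
  qed
  moreover have "surj \<sigma>"
    unfolding surj_def
  proof
    fix z
    \<comment> \<open>z is a root of some p over \<open>F\<close>. As \<sigma> fixes
      \<open>F\<close>, it maps the finite root set of p injectively into itself, hence
      onto.\<close>
    obtain p where p: "p \<noteq> 0" "\<forall>i. coeff p i \<in> F" "poly p z = 0"
      using R.alg by blast
    have "\<sigma> ` {x. poly p x = 0} \<subseteq> {x. poly p x = 0}"
    proof safe
      fix x assume "poly p x = 0"
      moreover have "(poly p x, poly p (\<sigma> x)) \<in> M"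
        using p(2) by (intro M.eval \<sigma>) (auto simp: graph_polys_def M.diag)
      ultimately show "poly p (\<sigma> x) = 0"
        using M.zero by auto
    qed
    then have "\<sigma> ` {x. poly p x = 0} = {x. poly p x = 0}"
      using inj poly_roots_finite[OF p(1)] by (intro endo_inj_surj) (auto simp: inj_on_def)
    with p(3) show "\<exists>x. z = \<sigma> x" by blast
  qed
  moreover have "\<sigma> 1 = 1"
    by (rule \<sigma>_eq) simp
  ultimately have "field_automorphism \<sigma>"
    using add mult by (auto simp: field_automorphism_def bij_def)
  then show thesis
    using that \<sigma>_eq M(2) by blast
qed

text \<open>The minimal polynomial of y over \<open>E\<close> is not linear, and it is separable in
  characteristic zero, so it has a second root, to which y can be sent over
  \<open>E\<close>.\<close>

theorem automorphism_moving_element: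
  fixes E :: "'a::alg_closed_field set"
  assumes char0: "\<And>n. n > 0 \<Longrightarrow> of_nat n \<noteq> (0::'a)"
    and "subfield_set E"
    and alg: "\<And>x. \<exists>p. p \<noteq> 0 \<and> (\<forall>i. coeff p i \<in> E) \<and> poly p x = 0"
    and y: "y \<notin> E"
  obtains \<sigma> where "field_automorphism \<sigma>" "\<And>x. x \<in> E \<Longrightarrow> \<sigma> x = x" "\<sigma> y \<noteq> y"
proof -
  \<comment> \<open>The starting graph is the identity of \<open>E\<close>, so a minimal pair over
    it is one polynomial taken twice.\<close>
  interpret partial_iso E "Id_on E"
    using assms by unfold_locales (auto simp: iso_graph_def subfield_setD)
  have gp: "(p, q) \<in> graph_polys (Id_on E) \<longleftrightarrow> q = p \<and> (\<forall>i. coeff p i \<in> E)" for p q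
    by (auto simp: graph_polys_def poly_eq_iff intro!: poly_eqI)
  obtain m where m: "minimal_pair y m m"
    using minimal_pair_exists[of y] by (metis gp minimal_pair_def)
  then have mE: "\<And>i. coeff m i \<in> E" "m \<noteq> 0" "poly m y = 0"
    and mmin: "\<And>p. \<forall>i. coeff p i \<in> E \<Longrightarrow> p \<noteq> 0 \<Longrightarrow> poly p y = 0 \<Longrightarrow> degree m \<le> degree p"
    by (auto simp: minimal_pair_def gp)
  obtain q where q: "m = [:-y, 1:] * q"
    using mE(3) by (metis dvdE poly_eq_0_iff_dvd)
  have q0: "q \<noteq> 0"
    using mE(2) q by auto
  have degm: "degree m = Suc (degree q)"
    using q0 unfolding q by (subst degree_mult_eq) auto
  have "degree q > 0"
  proof (rule ccontr)
    assume "\<not> degree q > 0"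
    then obtain a where a: "q = [:a:]"
      using degree_eq_zeroE by blast
    have "a \<noteq> 0" using a q0 by auto
    moreover have "- y * a \<in> E" "a \<in> E"
      using mE(1)[of 0] mE(1)[of 1] by (auto simp: q a mult.commute)
    ultimately have "- ((- y * a) / a) \<in> E"
      using subfield_setD(3)[OF F subfield_setD(8)[OF F]] by blast
    moreover have "- ((- y * a) / a) = y"
      using \<open>a \<noteq> 0\<close> by simp
    ultimately show False
      using y by metis
  qed
  then obtain y' where y': "poly q y' = 0"
    using alg_closed_imp_poly_has_root by blast
  \<comment> \<open>A double root y would be a root of the derivative, which is nonzero in
    characteristic zero, has coefficients in \<open>E\<close> and has smaller degree than m.\<close>
  have "y' \<noteq> y"
  proof
    assume "y' = y"
    then have "poly (pderiv m) y = 0"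
      using y' by (simp add: q pderiv_mult pderiv_pCons del: mult_pCons_left)
    moreover have "coeff (pderiv m) (degree q) \<noteq> 0"
      unfolding coeff_pderiv degm[symmetric] using char0[of "degree m"] leading_coeff_neq_0[of m] mE(2) degm
      by (simp del: of_nat_Suc)
    then have "pderiv m \<noteq> 0" by auto
    moreover have "coeff (pderiv m) i \<in> E" for i
    proof -
      have "of_nat k \<in> E" for k
        by (induction k) (simp_all add: subfield_setD(1,2,5)[OF F])
      then show ?thesis
        unfolding coeff_pderiv by (rule subfield_setD(6)[OF F _ mE(1)])
    qed
    ultimately have "degree m \<le> degree (pderiv m)"
      using mmin by blast
    moreover have "degree (pderiv m) \<le> degree q"
      by (rule degree_le) (simp add: coeff_pderiv coeff_eq_0 degm)
    ultimately show False
      using degm by simp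
  qed
  have root: "poly m y' = 0"
    using y' by (simp add: q)
  interpret P: partial_iso E "adjoin y y'"
    using F alg adjoin(1)[OF m root] by unfold_locales
  obtain \<sigma> where \<sigma>: "field_automorphism \<sigma>" "\<And>u v. (u, v) \<in> adjoin y y' \<Longrightarrow> \<sigma> u = v"
    using extend_partial_iso[OF P.partial_iso_axioms] by blast
  show thesis
    using that[OF \<sigma>(1)] \<sigma>(2) P.diag adjoin(3)[OF m root] \<open>y' \<noteq> y\<close> by auto
qed

section \<open>Evaluation of rational functions\<close>

locale field_hom =
  fixes h :: "'a::field \<Rightarrow> 'b::field"
  assumes hom_one [simp]: "h 1 = 1"
    and hom_add [simp]: "h (x + y) = h x + h y"
    and hom_mult [simp]: "h (x * y) = h x * h y"
begin

lemma hom_zero [simp]: "h 0 = 0"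
  by (metis add.right_neutral add_left_cancel hom_add)

lemma hom_uminus [simp]: "h (- x) = - h x"
  using hom_add[of x "- x"] by (simp add: add_eq_0_iff)

lemma hom_diff [simp]: "h (x - y) = h x - h y"
  using hom_add[of x "- y"] by simp

lemma hom_eq_0_iff [simp]: "h x = 0 \<longleftrightarrow> x = 0"
proof
  assume "h x = 0"
  then show "x = 0"
    using hom_mult[of x "inverse x"] by (cases "x = 0") auto
qed simp

lemma hom_inject [simp]: "h x = h y \<longleftrightarrow> x = y"
  using hom_eq_0_iff[of "x - y"] by (simp del: hom_eq_0_iff)

lemma hom_inverse [simp]: "h (inverse x) = inverse (h x)"
  using hom_mult[of x "inverse x"] by (cases "x = 0") (auto intro: inverse_unique[symmetric])

lemma hom_divide [simp]: "h (x / y) = h x / h y"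
  by (simp add: divide_inverse)

lemma hom_power [simp]: "h (x ^ n) = h x ^ n"
  by (induction n) auto

lemma hom_of_nat [simp]: "h (of_nat n) = of_nat n"
  by (induction n) auto

lemma map_pCons [simp]: "map_poly h (pCons a p) = pCons (h a) (map_poly h p)"
  by (cases "a = 0 \<and> p = 0") (auto simp: map_poly_pCons)

lemma map_add [simp]: "map_poly h (p + q) = map_poly h p + map_poly h q"
  by (intro poly_eqI) (simp add: coeff_map_poly)

lemma map_diff [simp]: "map_poly h (p - q) = map_poly h p - map_poly h q"
  by (intro poly_eqI) (simp add: coeff_map_poly)

lemma map_smult [simp]: "map_poly h (smult c p) = smult (h c) (map_poly h p)"
  by (intro poly_eqI) (simp add: coeff_map_poly)

lemma map_mult [simp]: "map_poly h (p * q) = map_poly h p * map_poly h q"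
  by (induction p) auto

lemma map_eq_0_iff [simp]: "map_poly h p = 0 \<longleftrightarrow> p = 0"
  by (auto simp: poly_eq_iff coeff_map_poly)

lemma map_one [simp]: "map_poly h 1 = 1"
  by (simp add: one_pCons)

lemma map_power [simp]: "map_poly h (p ^ n) = map_poly h p ^ n"
  by (induction n) auto

lemma degree_map [simp]: "degree (map_poly h p) = degree p"
  by (rule degree_map_poly) auto

lemma poly_map: "h (poly p x) = poly (map_poly h p) (h x)"
  by (induction p) auto

end

lemma map_poly_field_hom_comp:
  assumes "field_hom h1" "field_hom h2"
  shows "map_poly h2 (map_poly h1 p) = map_poly (\<lambda>x. h2 (h1 x)) p"
proof -
  interpret h1: field_hom h1 by fact
  interpret h2: field_hom h2 by fact
  show ?thesis
    by (intro poly_eqI) (simp add: coeff_map_poly)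
qed

text \<open>A nonzero element d of least degree in the ideal generated by p and q divides the whole
  ideal, by division with remainder; coprimality makes d a unit.\<close>

lemma coprime_poly_bezout:
  fixes p q :: "'a::field poly"
  assumes "coprime p q"
  obtains u v where "u * p + v * q = 1"
proof -
  define I where "I = {u * p + v * q | u v. True}"
  have Iadd: "a - b \<in> I" if ab: "a \<in> I" "b \<in> I" for a b
  proof -
    obtain u v u' v' where "a = u * p + v * q" "b = u' * p + v' * q"
      using ab unfolding I_def by blast
    then have "a - b = (u - u') * p + (v - v') * q"
      by (simp add: algebra_simps)
    then show ?thesis unfolding I_def by blast
  qed
  have Imult: "c * a \<in> I" if a: "a \<in> I" for a c
  proof -
    obtain u v where "a = u * p + v * q"
      using a unfolding I_def by blast
    then have "c * a = (c * u) * p + (c * v) * q"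
      by (simp add: algebra_simps)
    then show ?thesis unfolding I_def by blast
  qed
  have "1 * p + 0 * q \<in> I" "0 * p + 1 * q \<in> I"
    unfolding I_def by blast+
  then have pq: "p \<in> I" "q \<in> I"
    by simp_all
  have "p \<noteq> 0 \<or> q \<noteq> 0"
    using assms by auto
  then obtain d0 where "d0 \<in> I \<and> d0 \<noteq> 0"
    using pq by blast
  then have "\<exists>d. (d \<in> I \<and> d \<noteq> 0) \<and> (\<forall>e. e \<in> I \<and> e \<noteq> 0 \<longrightarrow> degree d \<le> degree e)"
    by (rule ex_has_least_nat)
  then obtain d where d: "d \<in> I" "d \<noteq> 0" "\<And>e. e \<in> I \<Longrightarrow> e \<noteq> 0 \<Longrightarrow> degree d \<le> degree e"
    by blast
  have dvd: "d dvd a" if "a \<in> I" for a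
  proof (rule ccontr)
    assume nd: "\<not> d dvd a"
    have "a mod d = a - (a div d) * d"
      by (simp add: minus_div_mult_eq_mod)
    then have "a mod d \<in> I"
      using Iadd Imult that d(1) by simp
    moreover have "a mod d \<noteq> 0"
      using nd by (simp add: dvd_eq_mod_eq_0)
    ultimately show False
      using d degree_mod_less'[of d a] by fastforce
  qed
  have "d dvd 1"
    using dvd pq assms coprime_common_divisor by blast
  then obtain e where "1 = e * d"
    by (auto simp: dvd_def mult.commute)
  then have "1 \<in> I"
    using Imult[OF d(1), of e] by simp
  then show thesis
    using that unfolding I_def by auto
qed

text \<open>In a representation whose denominator has least degree, only units can be
  cancelled.\<close>

lemma lowest_terms_exists:
  fixes g :: "'a::field poly fract"
  shows "\<exists>P Q. Q \<noteq> 0 \<and> coprime P Q \<and> g = Fraction_Field.Fract P Q"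
proof -
  define S where "S = (\<lambda>(P, Q). Q \<noteq> 0 \<and> g = Fraction_Field.Fract P Q)"
  obtain P0 Q0 where "S (P0, Q0)"
    by (cases g) (auto simp: S_def)
  then have "\<exists>x. S x \<and> (\<forall>y. S y \<longrightarrow> degree (snd x) \<le> degree (snd y))"
    by (rule ex_has_least_nat)
  then obtain P Q where PQ: "S (P, Q)" and least: "\<And>y. S y \<Longrightarrow> degree Q \<le> degree (snd y)"
    by fastforce
  have "coprime P Q"
  proof (rule coprimeI)
    fix c assume "c dvd P" "c dvd Q"
    then obtain P' Q' where c: "P = c * P'" "Q = c * Q'"
      by (auto simp: dvd_def)
    have 0: "c \<noteq> 0" "Q' \<noteq> 0"
      using PQ by (auto simp: S_def c)
    then have "S (P', Q')"
      using PQ by (auto simp: S_def c eq_fract)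
    from least[OF this] have "degree c = 0"
      using 0 by (simp add: c degree_mult_eq)
    then show "is_unit c"
      using 0 by (simp add: is_unit_iff_degree)
  qed
  then show ?thesis
    using PQ by (auto simp: S_def)
qed

lemma lowest_terms:
  obtains P Q where "lowest_terms g = (P, Q)" "Q \<noteq> 0" "coprime P Q" "g = Fraction_Field.Fract P Q"
proof -
  have "case lowest_terms g of (P, Q) \<Rightarrow> Q \<noteq> 0 \<and> coprime P Q \<and> g = Fraction_Field.Fract P Q"
    unfolding lowest_terms_def by (rule someI_ex) (use lowest_terms_exists[of g] in auto)
  then show thesis
    using that by (cases "lowest_terms g") auto
qed

text \<open>A Bezout identity survives any field extension, so no root is shared even outside the
  base field.\<close>

lemma (in field_hom) coprime_no_common_root:
  assumes "coprime P Q"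
  shows "poly (map_poly h P) x \<noteq> 0 \<or> poly (map_poly h Q) x \<noteq> 0"
proof -
  obtain u v where "u * P + v * Q = 1"
    using coprime_poly_bezout assms by blast
  then have "poly (map_poly h (u * P + v * Q)) x = 1"
    by simp
  then show ?thesis
    by auto
qed

lemma field_hom_poly_fract_const: "field_hom (\<lambda>c. frac_of [:c::'a::field:])"
  by unfold_locales (auto simp: frac_of_def eq_fract One_fract_def one_pCons)

section \<open>Evaluation at transcendental points\<close>

definition transcendental_over :: "('a::field \<Rightarrow> 'b::field) \<Rightarrow> 'b \<Rightarrow> bool" where
  "transcendental_over h x \<longleftrightarrow> (\<forall>p. p \<noteq> 0 \<longrightarrow> poly (map_poly h p) x \<noteq> 0)"

text \<open>Over an algebraically closed field every polynomial splits, so an algebraic element is a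
  constant. Transcendence can thus be checked as lying outside \<open>range h\<close>.\<close>

lemma transcendental_over_iff:
  fixes h :: "'a::alg_closed_field \<Rightarrow> 'b::field"
  assumes "field_hom h"
  shows "transcendental_over h x \<longleftrightarrow> x \<notin> range h"
proof
  interpret field_hom h by fact
  assume t: "transcendental_over h x"
  show "x \<notin> range h"
  proof
    assume "x \<in> range h"
    then obtain c where "x = h c" by blast
    then have "poly (map_poly h [:- c, 1:]) x = 0"
      by simp
    with t show False
      unfolding transcendental_over_def by (metis pCons_eq_0_iff zero_neq_one)
  qed
next
  interpret field_hom h by fact
  assume x: "x \<notin> range h"
  have "p \<noteq> 0 \<Longrightarrow> poly (map_poly h p) x \<noteq> 0" for p
  proof (induction "degree p" arbitrary: p rule: less_induct)
    case less
    show ?case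
    proof (cases "degree p = 0")
      case True
      then obtain a where "p = [:a:]"
        using degree_eq_zeroE by blast
      with less.prems show ?thesis by simp
    next
      case False
      then obtain c where "poly p c = 0"
        using alg_closed_imp_poly_has_root by blast
      then obtain q where q: "p = [:- c, 1:] * q"
        by (metis dvdE poly_eq_0_iff_dvd)
      then have q0: "q \<noteq> 0"
        using less.prems by auto
      then have "degree q < degree p"
        unfolding q by (subst degree_mult_eq) auto
      then have "poly (map_poly h q) x \<noteq> 0"
        using less.hyps q0 by blast
      moreover have "x \<noteq> h c"
        using x by blast
      moreover have "poly (map_poly h p) x = (x - h c) * poly (map_poly h q) x"
        by (simp only: q map_mult) (simp add: algebra_simps)
      ultimately show ?thesis
        by simp
    qed
  qed
  then show "transcendental_over h x"
    by (simp add: transcendental_over_def)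
qed

text \<open>No nonzero denominator vanishes at x, so evaluation at x becomes a genuine field
  homomorphism on rational functions.\<close>

locale field_hom_eval = field_hom h for h :: "'a::field \<Rightarrow> 'b::field" +
  fixes x :: 'b
  assumes transc: "transcendental_over h x"
begin

lemma poly_nonzero: "p \<noteq> 0 \<Longrightarrow> poly (map_poly h p) x \<noteq> 0"
  using transc by (simp add: transcendental_over_def)

lemma rat_eval_Fract:
  assumes "Q \<noteq> 0"
  shows "rat_eval h (Fraction_Field.Fract P Q) x = poly (map_poly h P) x / poly (map_poly h Q) x"
proof -
  obtain P' Q' where *: "lowest_terms (Fraction_Field.Fract P Q) = (P', Q')" "Q' \<noteq> 0"
    and eq: "Fraction_Field.Fract P Q = Fraction_Field.Fract P' Q'"
    using lowest_terms by metis
  then have "P * Q' = P' * Q"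
    using assms * eq by (simp add: eq_fract)
  then have "poly (map_poly h (P * Q')) x = poly (map_poly h (P' * Q)) x"
    by (rule arg_cong)
  then show ?thesis
    using poly_nonzero assms *(2) by (simp add: rat_eval_def * field_simps)
qed

lemma rat_eval_const: "rat_eval h (frac_of [:c:]) x = h c"
  by (simp add: frac_of_def rat_eval_Fract)

lemma rat_eval_X: "rat_eval h (frac_of [:0, 1:]) x = x"
  by (simp add: frac_of_def rat_eval_Fract)

lemma field_hom_rat_eval: "field_hom (\<lambda>g. rat_eval h g x)"
proof
  show "rat_eval h 1 x = 1"
    by (simp add: One_fract_def rat_eval_Fract)
  fix f g :: "'a poly fract"
  obtain P Q where f: "f = Fraction_Field.Fract P Q" "Q \<noteq> 0"
    by (cases f)
  obtain P' Q' where g: "g = Fraction_Field.Fract P' Q'" "Q' \<noteq> 0"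
    by (cases g)
  show "rat_eval h (f + g) x = rat_eval h f x + rat_eval h g x"
    "rat_eval h (f * g) x = rat_eval h f x * rat_eval h g x"
    using f(2) g(2) by (auto simp: f(1) g(1) rat_eval_Fract poly_nonzero field_simps)
qed

text \<open>Composition is itself an evaluation in the function field, and evaluation at x is a
  homomorphism that commutes with it. This includes constant \<open>g2\<close>, as division by zero
  gives 0 on both sides.\<close>

lemma rat_eval_rat_comp: "rat_eval h (rat_comp g1 g2) x = rat_eval h g1 (rat_eval h g2 x)"
proof -
  interpret e: field_hom "\<lambda>g. rat_eval h g x"
    by (rule field_hom_rat_eval)
  obtain P Q where PQ: "lowest_terms g1 = (P, Q)"
    by (cases "lowest_terms g1")
  have "map_poly (\<lambda>g. rat_eval h g x) (map_poly (\<lambda>c. frac_of [:c:]) p) = map_poly h p" for p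
    by (subst map_poly_field_hom_comp[OF field_hom_poly_fract_const e.field_hom_axioms])
      (simp add: rat_eval_const)
  then show ?thesis
    unfolding rat_comp_def by (simp add: rat_eval_def[of _ g1] PQ e.poly_map)
qed

lemma rat_eval_rat_iter: "rat_eval h (rat_iter n g) x = ((\<lambda>w. rat_eval h g w) ^^ n) x"
  by (induction n) (simp_all add: rat_iter_def rat_eval_X rat_eval_rat_comp)

end

text \<open>Only on \<open>S\<close> does \<sigma> respect the operations, because elements of a
  Galois group are extensional and carry no meaning outside their field.\<close>

lemma rat_eval_hom_on:
  assumes h: "field_hom h" and S: "subfield_set S" "range h \<subseteq> S" "x \<in> S"
    and add: "\<And>u v. u \<in> S \<Longrightarrow> v \<in> S \<Longrightarrow> \<sigma> (u + v) = \<sigma> u + \<sigma> v"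
    and mult: "\<And>u v. u \<in> S \<Longrightarrow> v \<in> S \<Longrightarrow> \<sigma> (u * v) = \<sigma> u * \<sigma> v"
    and const: "\<And>c. \<sigma> (h c) = h c"
  shows "\<sigma> (rat_eval h g x) = rat_eval h g (\<sigma> x)"
proof -
  interpret field_hom h by fact
  have poly_S: "poly (map_poly h p) x \<in> S" for p
    by (rule poly_in_subfield_set) (use S in \<open>auto simp: coeff_map_poly\<close>)
  have poly: "\<sigma> (poly (map_poly h p) x) = poly (map_poly h p) (\<sigma> x)" for p
  proof (induction p)
    case 0
    then show ?case using const[of 0] by simp
  next
    case (pCons a p)
    have "h a \<in> S" "x * poly (map_poly h p) x \<in> S"
      using S poly_S subfield_setD(6)[OF S(1)] by auto
    then show ?case
      using pCons.IH add mult poly_S S(3) const by simp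
  qed
  have inv: "\<sigma> (inverse u) = inverse (\<sigma> u)" if "u \<in> S" for u
  proof (cases "u = 0")
    case True
    then show ?thesis using const[of 0] by simp
  next
    case False
    have "\<sigma> (u * inverse u) = \<sigma> u * \<sigma> (inverse u)"
      using that subfield_setD(4)[OF S(1)] by (intro mult) auto
    then show ?thesis
      using False const[of 1] by (simp add: inverse_unique)
  qed
  obtain P Q where PQ: "lowest_terms g = (P, Q)"
    by (cases "lowest_terms g")
  have "inverse (poly (map_poly h Q) x) \<in> S"
    using subfield_setD(4)[OF S(1) poly_S] .
  then show ?thesis
    by (simp add: rat_eval_def PQ divide_inverse mult poly_S inv poly)
qed

lemma range_subfield_set:
  assumes "field_hom h"
  shows "subfield_set (range h)"
proof -
  interpret field_hom h by fact
  show ?thesis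
    unfolding subfield_set_def
    by (auto simp: hom_add[symmetric] hom_mult[symmetric] hom_inverse[symmetric]
        hom_uminus[symmetric] hom_one[symmetric]
        simp del: hom_add hom_mult hom_inverse hom_uminus hom_one)
qed

section \<open>Backward orbits and geometric iterated monodromy groups\<close>

text \<open>The embedding of the geometric constant field C, the algebraic closure of the field of
  coefficients; \<open>geom_const\<close> embeds only the latter. Points are studied over C because
  C is algebraically closed.\<close>

definition closure_const :: "'f::field alg_closure \<Rightarrow> 'f geom" where
  "closure_const c = to_ac (frac_of [:c:])"

lemma field_hom_to_ac: "field_hom to_ac"
  by unfold_locales auto

interpretation to_ac: field_hom to_ac
  by (rule field_hom_to_ac)

interpretation closure_const: field_hom closure_const
proof -
  interpret k: field_hom "\<lambda>c::'f::field alg_closure. frac_of [:c:]"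
    by (rule field_hom_poly_fract_const)
  show "field_hom (closure_const :: 'f::field alg_closure \<Rightarrow> 'f geom)"
    unfolding closure_const_def by unfold_locales simp_all
qed

lemma geom_const_eq: "geom_const c = closure_const (to_ac c)"
  by (simp add: geom_const_def closure_const_def)

interpretation geom_const: field_hom geom_const
  by unfold_locales (simp_all add: geom_const_eq)

lemma map_poly_geom_const: "map_poly geom_const p = map_poly closure_const (map_poly to_ac p)"
  by (intro poly_eqI) (simp add: coeff_map_poly geom_const_eq)

lemma field_hom_eval_closure_const: "x \<notin> range closure_const \<Longrightarrow> field_hom_eval closure_const x"
  by unfold_locales (simp add: transcendental_over_iff[OF closure_const.field_hom_axioms])

lemma field_hom_eval_geom_const: "x \<notin> range closure_const \<Longrightarrow> field_hom_eval geom_const x"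
  using field_hom_eval.poly_nonzero[OF field_hom_eval_closure_const, of x]
  by unfold_locales (simp add: transcendental_over_def map_poly_geom_const)

lemma geom_T_not_const: "(geom_T :: 'f::field geom) \<notin> range closure_const"
proof
  assume "(geom_T :: 'f geom) \<in> range closure_const"
  then obtain c :: "'f alg_closure" where "frac_of [:0, 1:] = frac_of [:c:]"
    by (auto simp: geom_T_def closure_const_def)
  then show False
    by (simp add: frac_of_def eq_fract)
qed

text \<open>Every element of C(T) is a rational function of T, so statements about
  \<open>geom_base\<close> reduce to the single element T.\<close>

lemma to_ac_eq_rat_eval: "to_ac r = rat_eval closure_const r geom_T"
proof -
  interpret T: field_hom_eval closure_const "geom_T :: 'a geom"
    by (rule field_hom_eval_closure_const[OF geom_T_not_const])
  have poly: "to_ac (frac_of A) = poly (map_poly closure_const A) geom_T" for A :: "'a alg_closure poly"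
  proof (induction A)
    case 0
    then show ?case
      using closure_const.hom_zero by (simp add: closure_const_def)
  next
    case (pCons a p)
    have "frac_of (pCons a p) = frac_of [:a:] + frac_of [:0, 1:] * frac_of p"
      by (simp add: frac_of_def)
    then show ?case
      using pCons.IH by (simp add: closure_const_def[symmetric] geom_T_def)
  qed
  obtain A B where r: "r = Fraction_Field.Fract A B" "B \<noteq> 0"
    by (cases r)
  then have "to_ac r = to_ac (frac_of A / frac_of B)"
    by (simp add: frac_of_def)
  then show ?thesis
    using r(2) by (simp add: poly T.rat_eval_Fract r(1))
qed

lemma subfield_set_geom_base: "subfield_set geom_base"
  unfolding geom_base_def by (rule range_subfield_set[OF field_hom_to_ac])

lemma closure_const_in_geom_base: "closure_const c \<in> geom_base"
  by (simp add: closure_const_def geom_base_def)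

lemma geom_T_in_geom_base: "geom_T \<in> geom_base"
  by (simp add: geom_T_def geom_base_def)

lemma algebraic_over_geom_base: "\<exists>p. p \<noteq> 0 \<and> (\<forall>i. coeff p i \<in> geom_base) \<and> poly p x = 0"
proof -
  obtain p where "p \<noteq> 0" "poly (map_poly to_ac p) x = 0"
    using alg_closure_algebraic[of x] by blast
  then show ?thesis
    by (intro exI[of _ "map_poly to_ac p"]) (simp add: coeff_map_poly geom_base_def)
qed

section \<open>Fibres of the iterates and the tower of splitting fields\<close>

abbreviation rat_map :: "'f::field poly fract \<Rightarrow> 'f geom \<Rightarrow> 'f geom" where
  "rat_map g \<equiv> rat_eval geom_const g"

lemma poly_closure_const_in_range:
  assumes "x \<in> range closure_const"
  shows "poly (map_poly geom_const p) x \<in> range closure_const"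
proof -
  obtain c where "x = closure_const c"
    using assms by blast
  then show ?thesis
    by (simp add: map_poly_geom_const closure_const.poly_map[symmetric])
qed

lemma rat_map_const:
  assumes "x \<in> range closure_const"
  shows "rat_map g x \<in> range closure_const"
  using poly_closure_const_in_range[OF assms]
    subfield_setD(8)[OF range_subfield_set[OF closure_const.field_hom_axioms]]
  by (simp only: rat_eval_def split: prod.split) blast

text \<open>The default value 0 at a pole is harmless, since x is not a constant and in particular
  not 0; coprimality excludes common zeros of P and Q.\<close>

lemma rat_map_eq_iff:
  assumes x: "x \<notin> range closure_const" and PQ: "lowest_terms g = (P, Q)"
  shows "rat_map g w = x \<longleftrightarrow> poly (map_poly geom_const P - smult x (map_poly geom_const Q)) w = 0"
proof -
  have cop: "coprime P Q"
    using lowest_terms[of g] PQ by (metis prod.inject)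
  have "rat_map g w = poly (map_poly geom_const P) w / poly (map_poly geom_const Q) w"
    by (simp add: rat_eval_def PQ)
  moreover have "x \<noteq> 0"
    using x closure_const.hom_zero by (metis rangeI)
  ultimately show ?thesis
    using geom_const.coprime_no_common_root[OF cop, of w]
    by (cases "poly (map_poly geom_const Q) w = 0") (auto simp: field_simps)
qed

text \<open>Transcendence rules out the points at which the iterates of \<open>g\<close> are not given by iterating the
  map \<open>rat_map g\<close>, whose value at a pole is the junk value \<open>0\<close>.\<close>
lemma preimages_T_iff:
  "x \<in> preimages_T n g \<longleftrightarrow> x \<notin> range closure_const \<and> (rat_map g ^^ n) x = geom_T"
proof -
  obtain P Q where PQ: "lowest_terms (rat_iter n g) = (P, Q)"
    by (cases "lowest_terms (rat_iter n g)")
  have 1: "x \<in> preimages_T n g \<longleftrightarrow> rat_map (rat_iter n g) x = geom_T"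
    using rat_map_eq_iff[OF geom_T_not_const PQ] by (simp add: preimages_T_def PQ)
  show ?thesis
  proof (cases "x \<in> range closure_const")
    case True
    then show ?thesis
      using 1 rat_map_const[OF True] geom_T_not_const by metis
  next
    case False
    then show ?thesis
      using 1 field_hom_eval.rat_eval_rat_iter[OF field_hom_eval_geom_const[OF False]] by simp
  qed
qed

text \<open>T is the n-th iterate of \<open>g\<close> at x. One rational function s serves all
  points of the fibre, and transitivity will depend on this uniformity.\<close>

lemma geom_T_rational_in_preimage:
  obtains s where "\<And>x. x \<in> preimages_T n g \<Longrightarrow> rat_eval closure_const s x = geom_T"
proof -
  obtain P Q where PQ: "lowest_terms (rat_iter n g) = (P, Q)" "Q \<noteq> 0"
    using lowest_terms by blast
  show thesis
  proof (rule that)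
    fix x assume x: "x \<in> preimages_T n g"
    then have xc: "x \<notin> range closure_const"
      by (simp add: preimages_T_iff)
    interpret field_hom_eval closure_const x
      by (rule field_hom_eval_closure_const[OF xc])
    have "rat_map (rat_iter n g) x = geom_T"
      using x rat_map_eq_iff[OF geom_T_not_const PQ(1)] by (simp add: preimages_T_def PQ(1))
    moreover have "map_poly to_ac Q \<noteq> 0"
      using PQ(2) by simp
    ultimately show "rat_eval closure_const (Fraction_Field.Fract (map_poly to_ac P) (map_poly to_ac Q)) x = geom_T"
      by (simp add: rat_eval_Fract) (simp add: rat_eval_def PQ map_poly_geom_const)
  qed
qed

lemma geom_base_rational_in_preimage:
  obtains s where "\<And>x r. x \<in> preimages_T n g \<Longrightarrow> to_ac r = rat_eval closure_const (rat_comp r s) x"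
proof -
  obtain s where s: "\<And>x. x \<in> preimages_T n g \<Longrightarrow> rat_eval closure_const s x = geom_T"
    using geom_T_rational_in_preimage by blast
  show thesis
  proof (rule that)
    fix x r assume x: "x \<in> preimages_T n g"
    then have "field_hom_eval closure_const x"
      by (simp add: preimages_T_iff field_hom_eval_closure_const)
    then show "to_ac r = rat_eval closure_const (rat_comp r s) x"
      by (simp add: field_hom_eval.rat_eval_rat_comp s[OF x] to_ac_eq_rat_eval)
  qed
qed

text \<open>The polynomial P - x Q could be constant only for a constant map \<open>g\<close>, and
  then T would be a constant as well; \<open>n \<ge> 1\<close> ensures that \<open>g\<close> is
  really applied on the way from x to T.\<close>

lemma preimage_lift:
  assumes x: "x \<in> preimages_T n g" and n: "n \<ge> 1"
  obtains w where "w \<in> preimages_T (Suc n) g" "rat_map g w = x"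
proof -
  have xc: "x \<notin> range closure_const" and xT: "(rat_map g ^^ n) x = geom_T"
    using x by (auto simp: preimages_T_iff)
  obtain P Q where PQ: "lowest_terms g = (P, Q)"
    by (cases "lowest_terms g")
  define p where "p = map_poly geom_const P - smult x (map_poly geom_const Q)"
  have "degree p > 0"
  proof (rule ccontr)
    assume "\<not> degree p > 0"
    then have 0: "coeff p i = 0" if "i > 0" for i
      using that by (simp add: coeff_eq_0)
    have coeffs: "coeff P i = 0 \<and> coeff Q i = 0" if "i > 0" for i
    proof -
      have eq: "geom_const (coeff P i) = x * geom_const (coeff Q i)"
        using 0[OF that] by (simp add: p_def coeff_map_poly)
      have "coeff Q i = 0"
      proof (rule ccontr)
        assume "coeff Q i \<noteq> 0"
        then have "x = geom_const (coeff P i / coeff Q i)"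
          using eq by (simp add: field_simps)
        then show False
          using xc by (simp add: geom_const_eq del: closure_const.hom_divide to_ac_divide to_ac.hom_divide)
      qed
      then show ?thesis
        using eq by simp
    qed
    have "degree P = 0" "degree Q = 0"
      using coeffs by (metis leading_coeff_0_iff degree_0 gr0I)+
    then obtain a b where "P = [:a:]" "Q = [:b:]"
      using degree_eq_zeroE by metis
    then have "rat_map g w = geom_const (a / b)" for w
      by (simp add: rat_eval_def PQ)
    moreover obtain m where "n = Suc m"
      using n by (cases n) auto
    ultimately have "geom_T = geom_const (a / b)"
      using xT by simp
    then show False
      using geom_T_not_const by (metis geom_const_eq rangeI)
  qed
  then obtain w where "poly p w = 0"
    using alg_closed_imp_poly_has_root by blast
  then have w: "rat_map g w = x"
    using rat_map_eq_iff[OF xc PQ] by (simp add: p_def)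
  have "w \<notin> range closure_const"
    using rat_map_const[of w g] xc unfolding w by blast
  moreover have "(rat_map g ^^ Suc n) w = geom_T"
    unfolding funpow_Suc_right o_def w by (rule xT)
  ultimately show thesis
    using that w by (simp only: preimages_T_iff simp_thms)
qed

lemma rat_map_in_subfield:
  assumes "subfield_set S" "geom_base \<subseteq> S" "x \<in> S"
  shows "rat_map g x \<in> S"
proof -
  have "poly (map_poly geom_const p) x \<in> S" for p
    by (rule poly_in_subfield_set)
      (use assms closure_const_in_geom_base in \<open>auto simp: coeff_map_poly geom_const_eq\<close>)
  then show ?thesis
    using subfield_setD(8)[OF assms(1)] by (simp only: rat_eval_def split: prod.split) blast
qed

lemma generate_field_type_algebra:
  fixes H :: "'a::field set"
  shows "subfield_set (generate_field ring_of_type_algebra H)"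
    and "subfield_set S \<Longrightarrow> H \<subseteq> S \<Longrightarrow> generate_field ring_of_type_algebra H \<subseteq> S"
proof -
  let ?R = "ring_of_type_algebra :: 'a ring"
  interpret R: field ?R
    by (rule field_from_type_algebra)
  have ops: "\<one>\<^bsub>?R\<^esub> = 1" "\<zero>\<^bsub>?R\<^esub> = 0" "add ?R = (+)" "monoid.mult ?R = (*)" "carrier ?R = UNIV"
    by (auto simp: ring_of_type_algebra_def)
  have uminus: "a_inv ?R x = - x" for x
    using R.minus_equality[of "- x" x] by (simp add: ops)
  have inverse: "m_inv ?R x = inverse x" if "x \<noteq> 0" for x
    using R.inv_char[of x "inverse x"] that by (simp add: ops)
  let ?K = "generate_field ?R H"
  have 0: "0 \<in> ?K"
    using generate_field.eng_add[OF generate_field.one generate_field.a_inv[OF generate_field.one], of ?R H]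
    by (simp add: ops uminus)
  show "subfield_set ?K"
    unfolding subfield_set_def
  proof (intro conjI ballI)
    show "1 \<in> ?K"
      using generate_field.one[of ?R H] by (simp add: ops)
    fix x assume x: "x \<in> ?K"
    show "- x \<in> ?K"
      using generate_field.a_inv[OF x] by (simp add: uminus)
    show "inverse x \<in> ?K"
      using generate_field.m_inv[OF x] 0 by (cases "x = 0") (simp_all add: inverse ops)
    fix y assume y: "y \<in> ?K"
    show "x + y \<in> ?K" "x * y \<in> ?K"
      using generate_field.eng_add[OF x y] generate_field.eng_mult[OF x y] by (simp_all add: ops)
  qed
  assume S: "subfield_set S" "H \<subseteq> S"
  show "?K \<subseteq> S"
  proof
    fix x assume "x \<in> ?K"
    then show "x \<in> S"
      by induction (use S in \<open>auto simp: ops uminus inverse subfield_setD\<close>)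
  qed
qed

text \<open>A point of level n is the image under \<open>g\<close> of a point of level n + 1. The
  fields thus form a chain, and their union is a field.\<close>

lemma splitting_K_Suc: "n \<ge> 1 \<Longrightarrow> splitting_K n g \<subseteq> splitting_K (Suc n) g"
  unfolding splitting_K_def
proof (rule generate_field_type_algebra(2)[OF generate_field_type_algebra(1)], rule Un_least)
  let ?K = "generate_field ring_of_type_algebra (geom_base \<union> preimages_T (Suc n) g)"
  assume n: "n \<ge> 1"
  show base: "geom_base \<subseteq> ?K"
    by (auto intro: generate_field.incl)
  show "preimages_T n g \<subseteq> ?K"
  proof
    fix x assume "x \<in> preimages_T n g"
    then obtain w where w: "w \<in> preimages_T (Suc n) g" "rat_map g w = x"
      using preimage_lift n by blast
    then have "w \<in> ?K"
      by (auto intro: generate_field.incl)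
    with base show "x \<in> ?K"
      unfolding w(2)[symmetric] by (intro rat_map_in_subfield generate_field_type_algebra(1))
  qed
qed

lemma splitting_K_mono:
  assumes "1 \<le> m" "m \<le> n"
  shows "splitting_K m g \<subseteq> splitting_K n g"
  using assms(2)
proof (induction n rule: dec_induct)
  case (step n)
  then show ?case
    using splitting_K_Suc[of n g] assms(1) by auto
qed simp

lemma subfield_set_splitting_K: "subfield_set (splitting_K n g)"
  unfolding splitting_K_def by (rule generate_field_type_algebra(1))

lemma subfield_set_K_infinity: "subfield_set (K_infinity g)"
  unfolding subfield_set_def
proof (intro conjI ballI)
  show "1 \<in> K_infinity g"
    unfolding K_infinity_def using subfield_setD(1)[OF subfield_set_splitting_K] by blast
  fix x assume "x \<in> K_infinity g"
  then obtain m where m: "m \<ge> 1" "x \<in> splitting_K m g"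
    by (auto simp: K_infinity_def)
  then show "- x \<in> K_infinity g" "inverse x \<in> K_infinity g"
    using subfield_setD(3,4)[OF subfield_set_splitting_K m(2)] unfolding K_infinity_def by force+
  fix y assume "y \<in> K_infinity g"
  then obtain n where n: "n \<ge> 1" "y \<in> splitting_K n g"
    by (auto simp: K_infinity_def)
  have "x \<in> splitting_K (max m n) g" "y \<in> splitting_K (max m n) g"
    using splitting_K_mono[of m "max m n" g] splitting_K_mono[of n "max m n" g] m n by auto
  then have "x + y \<in> splitting_K (max m n) g" "x * y \<in> splitting_K (max m n) g"
    by (auto intro: subfield_setD(5,6)[OF subfield_set_splitting_K])
  moreover have "max m n \<in> {1..}"
    using m by auto
  ultimately show "x + y \<in> K_infinity g" "x * y \<in> K_infinity g"
    unfolding K_infinity_def by blast+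
qed

lemma geom_base_subset_K_infinity: "geom_base \<subseteq> K_infinity g"
  unfolding K_infinity_def splitting_K_def by (auto intro: generate_field.incl)

lemma backward_orbit_subset_K_infinity: "backward_orbit g \<subseteq> K_infinity g"
  unfolding K_infinity_def splitting_K_def backward_orbit_def by (auto intro: generate_field.incl)

lemma K_infinity_least:
  assumes "subfield_set S" "geom_base \<subseteq> S" "backward_orbit g \<subseteq> S"
  shows "K_infinity g \<subseteq> S"
  unfolding K_infinity_def
proof (rule UN_least)
  fix n :: nat assume "n \<in> {1..}"
  then show "splitting_K n g \<subseteq> S"
    unfolding splitting_K_def using assms
    by (intro generate_field_type_algebra(2)) (auto simp: backward_orbit_def)
qed

lemma backward_orbit_not_const: "x \<in> backward_orbit g \<Longrightarrow> x \<notin> range closure_const"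
  by (auto simp: backward_orbit_def preimages_T_iff)

section \<open>Elements of the monodromy group and automorphisms of the algebraic closure\<close>

lemma geom_IMG_iff:
  "\<sigma> \<in> carrier (geom_IMG g) \<longleftrightarrow> \<sigma> \<in> extensional (K_infinity g) \<and> bij_betw \<sigma> (K_infinity g) (K_infinity g)
     \<and> (\<forall>x\<in>K_infinity g. \<forall>y\<in>K_infinity g. \<sigma> (x + y) = \<sigma> x + \<sigma> y \<and> \<sigma> (x * y) = \<sigma> x * \<sigma> y)
     \<and> (\<forall>x\<in>geom_base. \<sigma> x = x)"
proof -
  have "1 \<in> geom_base"
    using subfield_setD(1)[OF subfield_set_geom_base] .
  then show ?thesis
    by (auto simp: geom_IMG_def Galois_group_def Bij_def ring_hom_def ring_of_type_algebra_def
        dest: bij_betwE)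
qed

lemma field_automorphism_hom: "field_automorphism \<sigma> \<Longrightarrow> field_hom \<sigma>"
  by unfold_locales (auto simp: field_automorphism_def)

lemma field_automorphism_inv:
  assumes "field_automorphism \<sigma>"
  shows "field_automorphism (inv_into UNIV \<sigma>)"
proof -
  have bij: "bij \<sigma>" and hom: "\<sigma> 1 = 1" "\<And>x y. \<sigma> (x + y) = \<sigma> x + \<sigma> y" "\<And>x y. \<sigma> (x * y) = \<sigma> x * \<sigma> y"
    using assms by (auto simp: field_automorphism_def)
  have right: "\<sigma> (inv_into UNIV \<sigma> x) = x" and left: "inv_into UNIV \<sigma> (\<sigma> x) = x" for x
    using bij by (auto simp: bij_is_surj surj_f_inv_f bij_is_inj)
  have "inv_into UNIV \<sigma> x + inv_into UNIV \<sigma> y = inv_into UNIV \<sigma> (x + y)"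
    "inv_into UNIV \<sigma> x * inv_into UNIV \<sigma> y = inv_into UNIV \<sigma> (x * y)" for x y
    using left[of "inv_into UNIV \<sigma> x + inv_into UNIV \<sigma> y"]
      left[of "inv_into UNIV \<sigma> x * inv_into UNIV \<sigma> y"] by (simp_all add: hom right)
  moreover have "inv_into UNIV \<sigma> 1 = 1"
    using left[of 1] hom(1) by simp
  ultimately show ?thesis
    using bij_imp_bij_inv[OF bij] by (simp add: field_automorphism_def)
qed

lemma geom_const_in_geom_base: "geom_const c \<in> geom_base"
  by (simp add: geom_const_eq closure_const_in_geom_base)

text \<open>Two uses determine the form: \<open>S = K_infinity g\<close> for elements of the
  monodromy group, and \<open>S = UNIV\<close> for automorphisms of the whole algebraic
  closure.\<close>

lemma hom_preserves_preimages:
  assumes S: "subfield_set S" "geom_base \<subseteq> S"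
    and inj: "inj_on \<sigma> S"
    and add: "\<And>u v. u \<in> S \<Longrightarrow> v \<in> S \<Longrightarrow> \<sigma> (u + v) = \<sigma> u + \<sigma> v"
    and mult: "\<And>u v. u \<in> S \<Longrightarrow> v \<in> S \<Longrightarrow> \<sigma> (u * v) = \<sigma> u * \<sigma> v"
    and base: "\<And>x. x \<in> geom_base \<Longrightarrow> \<sigma> x = x"
    and x: "x \<in> S" "x \<in> preimages_T n g"
  shows "\<sigma> x \<in> preimages_T n g"
proof -
  have xc: "x \<notin> range closure_const" and xT: "(rat_map g ^^ n) x = geom_T"
    using x by (auto simp: preimages_T_iff)
  \<comment> \<open>Constants are fixed and \<sigma> is injective on \<open>S\<close>, so a
    non-constant cannot become constant.\<close>
  have "\<sigma> x \<notin> range closure_const"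
  proof
    assume "\<sigma> x \<in> range closure_const"
    then obtain c where "\<sigma> x = closure_const c"
      by blast
    then have "\<sigma> x = \<sigma> (closure_const c)"
      by (simp add: base closure_const_in_geom_base)
    then have "x = closure_const c"
      using inj x(1) S(2) closure_const_in_geom_base by (meson inj_onD subsetD)
    with xc show False by blast
  qed
  moreover have "(rat_map g ^^ m) x \<in> S \<and> \<sigma> ((rat_map g ^^ m) x) = (rat_map g ^^ m) (\<sigma> x)" for m
  proof (induction m)
    case (Suc m)
    have "\<sigma> (rat_map g ((rat_map g ^^ m) x)) = rat_map g (\<sigma> ((rat_map g ^^ m) x))"
      by (rule rat_eval_hom_on[OF geom_const.field_hom_axioms S(1)])
        (use Suc S add mult base in \<open>auto simp: subsetD[OF _ geom_const_in_geom_base] geom_const_in_geom_base\<close>)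
    with Suc rat_map_in_subfield[OF S] show ?case by simp
  qed (simp add: x)
  then have "(rat_map g ^^ n) (\<sigma> x) = geom_T"
    using base[OF geom_T_in_geom_base] xT by metis
  ultimately show ?thesis
    by (simp add: preimages_T_iff)
qed

lemma geom_IMG_preserves_preimages:
  assumes "\<sigma> \<in> carrier (geom_IMG g)" "x \<in> preimages_T n g" "n \<ge> 1"
  shows "\<sigma> x \<in> preimages_T n g"
proof (rule hom_preserves_preimages[of "K_infinity g" \<sigma> x n g])
  show "inj_on \<sigma> (K_infinity g)"
    using assms(1) by (auto simp: geom_IMG_iff bij_betw_def)
  have "x \<in> backward_orbit g"
    using assms(2,3) by (auto simp: backward_orbit_def)
  then show "x \<in> K_infinity g"
    using backward_orbit_subset_K_infinity by blast
qed (use assms subfield_set_K_infinity geom_base_subset_K_infinity in \<open>auto simp: geom_IMG_iff\<close>)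

text \<open>Normality of \<open>K_infinity g\<close> over C(T): the elements sent into it form a
  subfield that contains the generators.\<close>

lemma automorphism_maps_K_infinity:
  assumes \<sigma>: "field_automorphism \<sigma>" and base: "\<And>x. x \<in> geom_base \<Longrightarrow> \<sigma> x = x"
  shows "\<sigma> ` K_infinity g \<subseteq> K_infinity g"
proof -
  interpret field_hom \<sigma>
    using \<sigma> by (rule field_automorphism_hom)
  note K = subfield_setD[OF subfield_set_K_infinity[of g]]
  have "K_infinity g \<subseteq> {x. \<sigma> x \<in> K_infinity g}"
  proof (rule K_infinity_least)
    show "subfield_set {x. \<sigma> x \<in> K_infinity g}"
      by (simp add: subfield_set_def K)
    show "geom_base \<subseteq> {x. \<sigma> x \<in> K_infinity g}"
      using base subsetD[OF geom_base_subset_K_infinity] by auto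
    show "backward_orbit g \<subseteq> {x. \<sigma> x \<in> K_infinity g}"
    proof
      fix x assume "x \<in> backward_orbit g"
      then obtain n where n: "n \<ge> 1" "x \<in> preimages_T n g"
        by (auto simp: backward_orbit_def)
      have "subfield_set (UNIV :: 'a geom set)"
        by (simp add: subfield_set_def)
      then have "\<sigma> x \<in> preimages_T n g"
        using n(2) base by (intro hom_preserves_preimages[of UNIV \<sigma> x n g]) (auto simp: inj_on_def)
      then have "\<sigma> x \<in> backward_orbit g"
        using n(1) by (auto simp: backward_orbit_def)
      then show "x \<in> {x. \<sigma> x \<in> K_infinity g}"
        using backward_orbit_subset_K_infinity by blast
    qed
  qed
  then show ?thesis by blast
qed

lemma restrict_in_geom_IMG:
  assumes \<sigma>: "field_automorphism \<sigma>" and base: "\<And>x. x \<in> geom_base \<Longrightarrow> \<sigma> x = x"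
  shows "restrict \<sigma> (K_infinity g) \<in> carrier (geom_IMG g)"
proof -
  interpret field_hom \<sigma>
    using \<sigma> by (rule field_automorphism_hom)
  have bij: "bij \<sigma>"
    using \<sigma> by (simp add: field_automorphism_def)
  \<comment> \<open>The inverse automorphism also maps \<open>K_infinity g\<close> into itself,
    which makes the restriction surjective.\<close>
  let ?\<tau> = "inv_into UNIV \<sigma>"
  have "?\<tau> x = x" if "x \<in> geom_base" for x
    using base[OF that] bij by (metis bij_is_inj inv_f_f)
  then have "?\<tau> ` K_infinity g \<subseteq> K_infinity g"
    by (intro automorphism_maps_K_infinity field_automorphism_inv \<sigma>)
  then have "K_infinity g \<subseteq> \<sigma> ` K_infinity g"
    using bij by (metis bij_is_surj image_f_inv_f image_mono)
  then have "bij_betw \<sigma> (K_infinity g) (K_infinity g)"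
    using automorphism_maps_K_infinity[OF assms, of g] by (auto simp: bij_betw_def inj_on_def)
  then show ?thesis
    using base subfield_setD(5,6)[OF subfield_set_K_infinity[of g]]
    by (auto simp: geom_IMG_iff bij_betw_def inj_on_def subsetD[OF geom_base_subset_K_infinity])
qed

text \<open>C(x) and C(y) are both rational function fields, so x can be sent to y. The base C(T)
  stays fixed because T is the same rational function of x and of y. This replaces an irreducibility
  argument for the polynomial of the fibre.\<close>

lemma geom_IMG_transitive:
  assumes x: "x \<in> preimages_T n g" and y: "y \<in> preimages_T n g" and n: "n \<ge> 1"
  shows "\<exists>\<sigma>\<in>carrier (geom_IMG g). \<sigma> x = y"
proof -
  interpret X: field_hom_eval closure_const x
    using x by (simp add: preimages_T_iff field_hom_eval_closure_const)
  interpret Y: field_hom_eval closure_const y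
    using y by (simp add: preimages_T_iff field_hom_eval_closure_const)
  interpret evx: field_hom "\<lambda>r. rat_eval closure_const r x"
    by (rule X.field_hom_rat_eval)
  interpret evy: field_hom "\<lambda>r. rat_eval closure_const r y"
    by (rule Y.field_hom_rat_eval)
  define R where "R = range (\<lambda>r. (rat_eval closure_const r x, rat_eval closure_const r y))"
  have RI: "(rat_eval closure_const r x, rat_eval closure_const r y) \<in> R" for r
    by (simp add: R_def)
  obtain s where s: "\<And>x r. x \<in> preimages_T n g \<Longrightarrow> to_ac r = rat_eval closure_const (rat_comp r s) x"
    using geom_base_rational_in_preimage by blast
  have base: "(c, c) \<in> R" if c: "c \<in> geom_base" for c
  proof -
    obtain r where "c = to_ac r"
      using c by (auto simp: geom_base_def)
    then show ?thesis
      using RI[of "rat_comp r s"] by (simp only: s[OF x, symmetric] s[OF y, symmetric])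
  qed
  have "iso_graph geom_base R"
    unfolding iso_graph_def
  proof (intro conjI allI impI ballI)
    show "(c, c) \<in> R" if "c \<in> geom_base" for c
      using that by (rule base)
    fix u v u' v' assume "(u, v) \<in> R" "(u', v') \<in> R"
    then obtain r r' where "u = rat_eval closure_const r x" "v = rat_eval closure_const r y"
      "u' = rat_eval closure_const r' x" "v' = rat_eval closure_const r' y"
      by (auto simp: R_def)
    then show "(u + u', v + v') \<in> R" "(u * u', v * v') \<in> R"
      using RI[of "r + r'"] RI[of "r * r'"] by simp_all
  next
    show "v = 0" if "(0, v) \<in> R" for v
      using that by (auto simp: R_def)
  qed
  then have "partial_iso geom_base R"
    using subfield_set_geom_base algebraic_over_geom_base by unfold_locales
  then obtain \<sigma> where \<sigma>: "field_automorphism \<sigma>" "\<And>u v. (u, v) \<in> R \<Longrightarrow> \<sigma> u = v"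
    using extend_partial_iso by blast
  have "restrict \<sigma> (K_infinity g) \<in> carrier (geom_IMG g)"
    using \<sigma> base by (intro restrict_in_geom_IMG) auto
  moreover have "\<sigma> x = y"
    using \<sigma>(2)[OF RI[of "frac_of [:0, 1:]"]] by (simp add: X.rat_eval_X Y.rat_eval_X)
  moreover have "x \<in> K_infinity g"
    using x n backward_orbit_subset_K_infinity[of g] by (auto simp: backward_orbit_def)
  ultimately show ?thesis
    by (metis restrict_apply')
qed

section \<open>The field C(x) and the Galois correspondence\<close>

abbreviation const_adjoin :: "'f::field geom \<Rightarrow> 'f geom set" where
  "const_adjoin x \<equiv> range (\<lambda>r. rat_eval closure_const r x)"

lemma const_adjoin:
  assumes "x \<notin> range closure_const"
  shows "subfield_set (const_adjoin x)" "closure_const c \<in> const_adjoin x" "x \<in> const_adjoin x"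
proof -
  interpret field_hom_eval closure_const x
    using assms by (rule field_hom_eval_closure_const)
  show "subfield_set (const_adjoin x)"
    by (rule range_subfield_set[OF field_hom_rat_eval])
  show "closure_const c \<in> const_adjoin x"
    using rat_eval_const by (metis rangeI)
  show "x \<in> const_adjoin x"
    using rat_eval_X by (metis rangeI)
qed

lemma geom_base_subset_const_adjoin:
  assumes "x \<in> backward_orbit g"
  shows "geom_base \<subseteq> const_adjoin x"
proof -
  obtain n where "x \<in> preimages_T n g"
    using assms by (auto simp: backward_orbit_def)
  moreover obtain s where "\<And>x r. x \<in> preimages_T n g \<Longrightarrow> to_ac r = rat_eval closure_const (rat_comp r s) x"
    using geom_base_rational_in_preimage by blast
  ultimately show ?thesis
    unfolding geom_base_def by (metis image_subsetI rangeI)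
qed

text \<open>Galois correspondence for \<open>const_adjoin x\<close>, whose group is normal as soon as the whole group
  commutes at \<open>x\<close>.\<close>
lemma geom_IMG_commuting_imp_rational:
  fixes g :: "'f::field poly fract"
  assumes char0: "CHAR('f) = 0" and x: "x \<in> backward_orbit g"
    and comm: "\<And>\<sigma> \<tau>. \<sigma> \<in> carrier (geom_IMG g) \<Longrightarrow> \<tau> \<in> carrier (geom_IMG g) \<Longrightarrow> \<sigma> (\<tau> x) = \<tau> (\<sigma> x)"
    and \<sigma>: "\<sigma> \<in> carrier (geom_IMG g)"
  shows "\<sigma> x \<in> const_adjoin x"
proof (rule ccontr)
  assume not_in: "\<sigma> x \<notin> const_adjoin x"
  note xc = backward_orbit_not_const[OF x]
  have K: "x \<in> K_infinity g" "\<sigma> x \<in> K_infinity g"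
    using x \<sigma> backward_orbit_subset_K_infinity[of g] by (auto simp: geom_IMG_iff bij_betw_def)
  have "of_nat n \<noteq> (0 :: 'f geom)" if "n > 0" for n
  proof
    assume "of_nat n = (0 :: 'f geom)"
    then have "geom_const (of_nat n :: 'f) = 0"
      by simp
    then have "of_nat n = (0 :: 'f)"
      by (simp only: geom_const.hom_eq_0_iff)
    then show False
      using that char0 by (simp add: of_nat_eq_0_iff_char_dvd)
  qed
  moreover have "\<exists>p. p \<noteq> 0 \<and> (\<forall>i. coeff p i \<in> const_adjoin x) \<and> poly p z = 0" for z
    using algebraic_over_geom_base[of z] geom_base_subset_const_adjoin[OF x] by (meson subsetD)
  \<comment> \<open>An automorphism \<tau> over C(x) that moves \<sigma> x contradicts
    commutativity, as \<tau> (\<sigma> x) = \<sigma> (\<tau> x) = \<sigma> x.\<close>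
  ultimately obtain \<tau> where \<tau>: "field_automorphism \<tau>" "\<And>z. z \<in> const_adjoin x \<Longrightarrow> \<tau> z = z" "\<tau> (\<sigma> x) \<noteq> \<sigma> x"
    using automorphism_moving_element[OF _ const_adjoin(1)[OF xc] _ not_in] by blast
  then have "restrict \<tau> (K_infinity g) \<in> carrier (geom_IMG g)"
    using geom_base_subset_const_adjoin[OF x] by (intro restrict_in_geom_IMG) auto
  from comm[OF \<sigma> this] show False
    using \<tau>(2)[OF const_adjoin(3)[OF xc]] \<tau>(3) K by simp
qed

lemma compose_in_geom_IMG:
  assumes "\<sigma> \<in> carrier (geom_IMG g)" "\<tau> \<in> carrier (geom_IMG g)"
  shows "compose (K_infinity g) \<sigma> \<tau> \<in> carrier (geom_IMG g)"
proof -
  have \<tau>: "\<tau> x \<in> K_infinity g" if "x \<in> K_infinity g" for x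
    using assms(2) that by (auto simp: geom_IMG_iff bij_betw_def)
  show ?thesis
    using assms \<tau> subfield_setD(5,6)[OF subfield_set_K_infinity[of g]]
    by (auto simp: geom_IMG_iff compose_eq subsetD[OF geom_base_subset_K_infinity] intro: bij_betw_compose)
qed

section \<open>Moebius transformations over an algebraically closed field\<close>

text \<open>In a finite field the product of all X - c, plus 1, has no root. The hypothesis on roots
  is explicit because the residue field is algebraically closed only as a ring record.\<close>

lemma infinite_if_polys_have_roots:
  assumes root: "\<And>p :: 'a::field poly. degree p > 0 \<Longrightarrow> \<exists>x. poly p x = 0"
  shows "infinite (UNIV :: 'a set)"
proof
  assume fin: "finite (UNIV :: 'a set)"
  define p where "p = (\<Prod>c\<in>(UNIV :: 'a set). [:- c, 1:]) + 1"
  have "poly p x = 1" for x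
  proof -
    have "(\<Prod>c\<in>(UNIV :: 'a set). x - c) = 0"
      using fin by (intro prod_zero) auto
    then show ?thesis
      by (simp add: p_def poly_prod)
  qed
  moreover have "degree p > 0"
  proof -
    have "degree (\<Prod>c\<in>(UNIV :: 'a set). [:- c, 1:]) = card (UNIV :: 'a set)"
      by (subst degree_prod_eq_sum_degree) auto
    moreover have "card (UNIV :: 'a set) > 0"
      using fin by (simp add: card_gt_0_iff)
    ultimately show ?thesis
      unfolding p_def by (subst degree_add_eq_left) auto
  qed
  ultimately show False
    using root[of p] by auto
qed

lemma pderiv_eq_0_char_0:
  fixes p :: "'a::field poly"
  assumes char0: "\<And>n. n > 0 \<Longrightarrow> of_nat n \<noteq> (0 :: 'a)" and "pderiv p = 0"
  shows "degree p = 0"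
proof (rule ccontr)
  assume "degree p \<noteq> 0"
  then obtain n where n: "degree p = Suc n"
    using not0_implies_Suc by blast
  have "coeff (pderiv p) n = of_nat (degree p) * lead_coeff p"
    by (simp add: coeff_pderiv n)
  moreover have "lead_coeff p \<noteq> 0"
    using n by (metis degree_0 leading_coeff_0_iff nat.distinct(1))
  ultimately show False
    using char0[of "degree p"] assms(2) n by (simp del: of_nat_Suc)
qed

lemma coprime_poly_dvd_mult:
  fixes A B :: "'a::field poly"
  assumes "coprime A B" "B dvd A * z"
  shows "B dvd z"
proof -
  obtain u v where "u * A + v * B = 1"
    using coprime_poly_bezout assms(1) by blast
  then have "z = (u * A + v * B) * z"
    by simp
  also have "\<dots> = u * (A * z) + (v * z) * B"
    by (simp add: algebra_simps)
  also have "B dvd \<dots>"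
    by (rule dvd_add[OF dvd_mult[OF assms(2)] dvd_triv_right])
  finally show ?thesis .
qed

lemma coprime_poly_no_common_root:
  fixes P Q :: "'a::field poly"
  assumes "coprime P Q"
  shows "poly P x \<noteq> 0 \<or> poly Q x \<noteq> 0"
proof -
  have "field_hom (\<lambda>x::'a. x)"
    by unfold_locales auto
  from field_hom.coprime_no_common_root[OF this assms, of x] show ?thesis
    by (simp add: map_poly_idI)
qed

text \<open>For all but finitely many r, the polynomial A - r B has degree at least 2 and only
  simple roots, since a double root is a zero of the derivative of A / B. Two of its roots are the
  points sought.\<close>

lemma rational_function_not_injective:
  fixes A B :: "'a::alg_closed_field poly"
  assumes char0: "\<And>n. n > 0 \<Longrightarrow> of_nat n \<noteq> (0 :: 'a)"
    and cop: "coprime A B" and deg: "degree A \<ge> 2 \<or> degree B \<ge> 2"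
  obtains c c' r where "c \<noteq> c'" "poly B c \<noteq> 0" "poly B c' \<noteq> 0"
    "poly A c = r * poly B c" "poly A c' = r * poly B c'"
proof -
  have no_common: "poly A c \<noteq> 0 \<or> poly B c \<noteq> 0" for c
    using cop by (rule coprime_poly_no_common_root)
  \<comment> \<open>The numerator of the derivative of A / B. If it vanished, coprimality would make
    A and B divide their own derivatives, which would then be zero; in characteristic zero both
    would be constant.\<close>
  define W where "W = pderiv A * B - A * pderiv B"
  have "W \<noteq> 0"
  proof
    assume "W = 0"
    then have eq: "pderiv A * B = A * pderiv B"
      by (simp add: W_def)
    then have "B dvd A * pderiv B" "A dvd B * pderiv A"
      by (metis dvd_triv_right, metis dvd_triv_left mult.commute)
    then have "B dvd pderiv B" "A dvd pderiv A"
      using coprime_poly_dvd_mult cop coprime_commute by blast+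
    moreover have "pderiv q = 0" if "q dvd pderiv q" for q :: "'a poly"
    proof (rule ccontr)
      assume "pderiv q \<noteq> 0"
      with that have "degree q \<le> degree (pderiv q)"
        by (rule dvd_imp_degree_le)
      moreover have "degree q \<noteq> 0"
        using \<open>pderiv q \<noteq> 0\<close> by (metis degree_eq_zeroE pderiv_0 pderiv_singleton)
      moreover have "degree (pderiv q) \<le> degree q - 1"
        by (rule degree_le) (auto simp: coeff_pderiv coeff_eq_0)
      ultimately show False by simp
    qed
    ultimately have "degree A = 0" "degree B = 0"
      using pderiv_eq_0_char_0[OF char0] by blast+
    with deg show False by simp
  qed
  \<comment> \<open>There is at most one such r: two of them would make B, and then A, of degree
    below 2.\<close>
  have fin_deg: "finite {r. degree (A - smult r B) < 2}"
  proof -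
    have "r = s" if r: "degree (A - smult r B) < 2" and s: "degree (A - smult s B) < 2" for r s
    proof (rule ccontr)
      assume rs: "r \<noteq> s"
      have "smult (r - s) B = (A - smult s B) - (A - smult r B)"
        by (simp add: smult_diff_left)
      then have "degree (smult (r - s) B) < 2"
        using degree_diff_less[OF s r] by simp
      then have B: "degree B < 2"
        using rs by simp
      have "degree (A - smult r B + smult r B) < 2"
        using r B by (intro degree_add_less) auto
      with B deg show False by simp
    qed
    then show ?thesis
      by (metis (mono_tags, lifting) finite.emptyI finite.insertI finite_subset insertI1 mem_Collect_eq subsetI)
  qed
  have "finite ({r. degree (A - smult r B) < 2} \<union> (\<lambda>c. poly A c / poly B c) ` {c. poly W c = 0})"
    using fin_deg poly_roots_finite[OF \<open>W \<noteq> 0\<close>] by auto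
  from ex_new_if_finite[OF infinite_if_polys_have_roots[OF alg_closed_imp_poly_has_root] this]
  obtain r where r: "degree (A - smult r B) \<ge> 2"
    "\<And>c. poly W c = 0 \<Longrightarrow> r \<noteq> poly A c / poly B c"
    by (auto simp: not_less)
  define p where "p = A - smult r B"
  have root: "poly B c \<noteq> 0 \<and> poly A c = r * poly B c" if "poly p c = 0" for c
    using that no_common[of c] by (auto simp: p_def)
  obtain c where c: "poly p c = 0"
    using alg_closed_imp_poly_has_root[of p] r(1) by (auto simp: p_def)
  then obtain q where q: "p = [:- c, 1:] * q"
    by (metis dvdE poly_eq_0_iff_dvd)
  have "q \<noteq> 0"
    using r(1) q by (auto simp: p_def[symmetric])
  then have "degree p = Suc (degree q)"
    unfolding q by (subst degree_mult_eq) auto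
  then have "degree q > 0"
    using r(1) by (simp add: p_def)
  then obtain c' where c': "poly q c' = 0"
    using alg_closed_imp_poly_has_root by blast
  have "c \<noteq> c'"
  proof
    assume "c = c'"
    then have "poly (pderiv p) c = 0"
      using c' by (simp add: q pderiv_mult pderiv_pCons del: mult_pCons_left)
    then have "poly (pderiv A) c = r * poly (pderiv B) c"
      by (simp add: p_def pderiv_diff pderiv_smult)
    then have "poly W c = 0"
      using root[OF c] by (simp add: W_def)
    moreover have "r = poly A c / poly B c"
      using root[OF c] by simp
    ultimately show False
      using r(2) by blast
  qed
  moreover have "poly p c' = 0"
    using c' by (simp add: q)
  ultimately show thesis
    using that root c by blast
qed

text \<open>With the denominator cleared, poles need no separate value, and a homomorphism fixing
  the constants preserves the equation.\<close>

definition moebius_related :: "('c::field \<Rightarrow> 'o::field) \<Rightarrow> 'o \<Rightarrow> 'o \<Rightarrow> bool" where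
  "moebius_related h x y \<longleftrightarrow>
     (\<exists>a b c d. a * d \<noteq> b * c \<and> y * (h c * x + h d) = h a * x + h b)"

locale constant_field = field_hom h for h :: "'c::alg_closed_field \<Rightarrow> 'o::field" +
  assumes char0: "\<And>n. n > 0 \<Longrightarrow> of_nat n \<noteq> (0 :: 'c)"
begin

text \<open>H clears the denominators of U(A / B). One H and one exponent e serve both constants c
  and points x above them, so that a relation at a transcendental x can be read off at
  constants.\<close>

lemma homogenize:
  "\<exists>H e. (\<forall>c. poly B c \<noteq> 0 \<longrightarrow> poly H c = poly B c ^ e * poly U (poly A c / poly B c)) \<and>
     (\<forall>x. poly (map_poly h B) x \<noteq> 0 \<longrightarrow> poly (map_poly h H) x =
        poly (map_poly h B) x ^ e * poly (map_poly h U) (poly (map_poly h A) x / poly (map_poly h B) x))"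
proof (induction U)
  case 0
  show ?case by (intro exI[of _ 0]) simp
next
  case (pCons a U)
  then obtain H e where
    H1: "\<And>c. poly B c \<noteq> 0 \<Longrightarrow> poly H c = poly B c ^ e * poly U (poly A c / poly B c)" and
    H2: "\<And>x. poly (map_poly h B) x \<noteq> 0 \<Longrightarrow> poly (map_poly h H) x =
        poly (map_poly h B) x ^ e * poly (map_poly h U) (poly (map_poly h A) x / poly (map_poly h B) x)"
    by auto
  show ?case
    by (rule exI[of _ "smult a (B ^ Suc e) + A * H"], rule exI[of _ "Suc e"])
      (auto simp: H1 H2 field_simps)
qed

text \<open>If \<open>x = s(y)\<close> and \<open>y = r(x)\<close>, then \<open>s \<circ> r\<close> is the identity, so \<open>r\<close> is injective.\<close>
lemma mutually_rational_imp_moebius_related: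
  assumes x: "x \<notin> range h" and y: "y \<notin> range h"
    and yr: "y = rat_eval h r x" and xs: "x = rat_eval h s y"
  shows "moebius_related h x y"
proof -
  interpret X: field_hom_eval h x
    using x by unfold_locales (simp add: transcendental_over_iff[OF field_hom_axioms])
  interpret Y: field_hom_eval h y
    using y by unfold_locales (simp add: transcendental_over_iff[OF field_hom_axioms])
  obtain A B where AB: "B \<noteq> 0" "coprime A B" "r = Fraction_Field.Fract A B"
    using lowest_terms by metis
  obtain U V where UV: "V \<noteq> 0" "coprime U V" "s = Fraction_Field.Fract U V"
    using lowest_terms by metis
  have yAB: "y = poly (map_poly h A) x / poly (map_poly h B) x"
    using AB yr by (simp add: X.rat_eval_Fract)
  have Bx: "poly (map_poly h B) x \<noteq> 0"
    using AB(1) by (rule X.poly_nonzero)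
  have xUV: "x * poly (map_poly h V) y = poly (map_poly h U) y"
    using UV xs Y.rat_eval_Fract[OF UV(1), of U] Y.poly_nonzero[OF UV(1)] by (simp add: field_simps)
  obtain HU eU where
    HU1: "\<And>c. poly B c \<noteq> 0 \<Longrightarrow> poly HU c = poly B c ^ eU * poly U (poly A c / poly B c)" and
    HU2: "poly (map_poly h HU) x = poly (map_poly h B) x ^ eU * poly (map_poly h U) y"
    using homogenize[of B U A] Bx yAB by metis
  obtain HV eV where
    HV1: "\<And>c. poly B c \<noteq> 0 \<Longrightarrow> poly HV c = poly B c ^ eV * poly V (poly A c / poly B c)" and
    HV2: "poly (map_poly h HV) x = poly (map_poly h B) x ^ eV * poly (map_poly h V) y"
    using homogenize[of B V A] Bx yAB by metis
  \<comment> \<open>The numerator of z - s(r(z)); the crossed exponents give both terms the common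
    factor \<open>B ^ (eU + eV)\<close>. It vanishes at the transcendental x, hence
    identically.\<close>
  define p where "p = [:0, 1:] * HV * B ^ eU - HU * B ^ eV"
  have "poly (map_poly h p) x = 0"
    by (simp add: p_def HU2 HV2 xUV[symmetric])
  then have "p = 0"
    using X.poly_nonzero by blast
  have sr: "c * poly V (poly A c / poly B c) = poly U (poly A c / poly B c)" if "poly B c \<noteq> 0" for c
  proof -
    have "poly p c = 0"
      using \<open>p = 0\<close> by simp
    then have "poly B c ^ eU * poly B c ^ eV * (c * poly V (poly A c / poly B c)) =
        poly B c ^ eU * poly B c ^ eV * poly U (poly A c / poly B c)"
      using that by (simp add: p_def HU1 HV1 mult_ac)
    then show ?thesis
      using that by simp
  qed
  have "\<not> (degree A \<ge> 2 \<or> degree B \<ge> 2)"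
  proof
    assume "degree A \<ge> 2 \<or> degree B \<ge> 2"
    then obtain c c' z where c: "c \<noteq> c'" "poly B c \<noteq> 0" "poly B c' \<noteq> 0"
      "poly A c = z * poly B c" "poly A c' = z * poly B c'"
      using rational_function_not_injective[OF char0 AB(2)] by metis
    \<comment> \<open>Two points with the same value z would both equal s(z). Without division this
      reads U(z) = V(z) = 0, against coprimality.\<close>
    have "c * poly V z = poly U z" "c' * poly V z = poly U z"
      using sr[OF c(2)] sr[OF c(3)] c by simp_all
    then have "poly V z = 0" "poly U z = 0"
      using c(1) by (metis mult_right_cancel, metis mult_right_cancel mult_zero_right)
    then show False
      using coprime_poly_no_common_root[OF UV(2), of z] by simp
  qed
  then have "degree A \<le> 1" "degree B \<le> 1"
    by auto
  moreover have "p = [:coeff p 0, coeff p 1:]" if "degree p \<le> 1" for p :: "'c poly"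
    using that by (intro poly_eqI) (auto simp: coeff_pCons coeff_eq_0 split: nat.split)
  ultimately obtain a b c d where A: "A = [:b, a:]" and B: "B = [:d, c:]"
    by metis
  have eq: "y * (h c * x + h d) = h a * x + h b"
    using yAB Bx by (simp add: A B field_simps)
  \<comment> \<open>With determinant zero the quotient (a x + b) / (c x + d) would not depend on x,
    and y would be a constant.\<close>
  have "a * d \<noteq> b * c"
  proof
    assume det: "a * d = b * c"
    have "y \<in> range h"
    proof (cases "c = 0")
      case True
      then have "d \<noteq> 0"
        using AB(1) by (auto simp: B)
      then have "y = h (b / d)"
        using True det eq by (simp add: field_simps)
      then show ?thesis by blast
    next
      case False
      have "h c * (h a * x + h b) = h a * (h c * x + h d)"
        using arg_cong[OF det, of h] by (simp add: algebra_simps)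
      then have "(h c * y) * (h c * x + h d) = h a * (h c * x + h d)"
        using eq by (simp only: mult.assoc)
      moreover have "h c * x + h d \<noteq> 0"
        using Bx by (simp add: B add.commute mult.commute)
      ultimately have "h c * y = h a"
        by (simp only: mult_cancel_right) simp
      then have "y = h (a / c)"
        using False by (simp add: field_simps)
      then show ?thesis by blast
    qed
    with y show False by blast
  qed
  with eq show ?thesis
    unfolding moebius_related_def by blast
qed

end

section \<open>Commuting Moebius transformations of finite exponent\<close>

lemma card_power_roots:
  assumes "p > 0"
  shows "finite {z::'a::field. z ^ p = c}" "card {z::'a. z ^ p = c} \<le> p"
proof -
  define P where "P = monom (1::'a) p - [:c:]"
  have "coeff P p = 1"
    using assms by (auto simp: P_def coeff_pCons split: nat.split)
  then have P: "P \<noteq> 0"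
    by auto
  have "degree P \<le> p"
    unfolding P_def by (rule degree_diff_le) (simp_all add: degree_monom_le)
  moreover have "{z. z ^ p = c} = {z. poly P z = 0}"
    by (auto simp: P_def poly_monom)
  ultimately show "finite {z::'a. z ^ p = c}" "card {z::'a. z ^ p = c} \<le> p"
    using poly_roots_finite[OF P] card_poly_roots_bound[OF P] by auto
qed

context constant_field
begin

lemma linear_zero:
  assumes "x \<notin> range h" "h a * x + h b = 0"
  shows "a = 0" "b = 0"
proof -
  show "a = 0"
  proof (rule ccontr)
    assume "a \<noteq> 0"
    then have "x = h (- b / a)"
      using assms(2) by (simp add: field_simps add_eq_0_iff)
    with assms(1) show False by blast
  qed
  with assms(2) show "b = 0" by simp
qed

lemma moebius_related_refl: "moebius_related h x x"
  unfolding moebius_related_def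
  by (rule exI[of _ 1], rule exI[of _ 0], rule exI[of _ 0], rule exI[of _ 1]) simp

lemma moebius_related_sym:
  assumes "moebius_related h x y"
  shows "moebius_related h y x"
proof -
  obtain a b c d where "a * d \<noteq> b * c" "y * (h c * x + h d) = h a * x + h b"
    using assms by (auto simp: moebius_related_def)
  then have "(- d) * (- a) \<noteq> b * c" "x * (h c * y + h (- a)) = h (- d) * y + h b"
    by (auto simp: algebra_simps)
  then show ?thesis
    unfolding moebius_related_def by blast
qed

lemma moebius_related_trans:
  assumes "moebius_related h x y" "moebius_related h y z" "x \<notin> range h"
  shows "moebius_related h x z"
proof -
  obtain a b c d where 1: "a * d \<noteq> b * c" "y * (h c * x + h d) = h a * x + h b"
    using assms(1) by (auto simp: moebius_related_def)
  obtain a' b' c' d' where 2: "a' * d' \<noteq> b' * c'" "z * (h c' * y + h d') = h a' * y + h b'"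
    using assms(2) by (auto simp: moebius_related_def)
  let ?a = "a' * a + b' * c" let ?b = "a' * b + b' * d"
  let ?c = "c' * a + d' * c" let ?d = "c' * b + d' * d"
  have "?a * ?d - ?b * ?c = (a' * d' - b' * c') * (a * d - b * c)"
    by (simp add: algebra_simps)
  then have "?a * ?d \<noteq> ?b * ?c"
    using 1(1) 2(1) by auto
  moreover have "z * (h ?c * x + h ?d) = h ?a * x + h ?b"
  proof -
    have "z * (h ?c * x + h ?d) = z * (h c' * (h a * x + h b) + h d' * (h c * x + h d))"
      by (simp add: algebra_simps)
    also have "\<dots> = (z * (h c' * y + h d')) * (h c * x + h d)"
      unfolding 1(2)[symmetric] by (simp add: algebra_simps)
    also have "\<dots> = h a' * (y * (h c * x + h d)) + h b' * (h c * x + h d)"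
      unfolding 2(2) by (simp add: algebra_simps)
    also have "\<dots> = h ?a * x + h ?b"
      unfolding 1(2) by (simp add: algebra_simps)
    finally show ?thesis .
  qed
  ultimately show ?thesis
    unfolding moebius_related_def by blast
qed

lemma moebius_related_not_const:
  assumes "moebius_related h x y" "x \<notin> range h"
  shows "y \<notin> range h"
proof
  assume "y \<in> range h"
  then obtain e where e: "y = h e" by blast
  obtain a b c d where 1: "a * d \<noteq> b * c" "y * (h c * x + h d) = h a * x + h b"
    using assms(1) by (auto simp: moebius_related_def)
  have "h (e * c - a) * x + h (e * d - b) = 0"
    using 1(2) by (simp add: e algebra_simps)
  from linear_zero[OF assms(2) this] have "a = e * c" "b = e * d"
    by auto
  with 1(1) show False by simp
qed

text \<open>The coordinate moves one fixed point of the transformation \<open>y = (a x + b) / (c x + d)\<close> to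
  infinity.\<close>
lemma affine_coordinate:
  assumes x: "x \<notin> range h" and y: "y \<notin> range h" and det: "a * d \<noteq> b * c"
    and eq: "y * (h c * x + h d) = h a * x + h b" and c: "c \<noteq> 0"
  obtains r \<alpha> \<beta> where "inverse (y - h r) = h \<alpha> * inverse (x - h r) + h \<beta>"
proof -
  \<comment> \<open>The roots of c z^2 + (d - a) z - b are the finite fixed points of the
    transformation.\<close>
  obtain r where r: "poly [:- b, d - a, c:] r = 0"
    using alg_closed_imp_poly_has_root[of "[:- b, d - a, c:]"] c by auto
  then have b: "b = c * r * r + (d - a) * r"
    by (simp add: algebra_simps)
  define k where "k = a - c * r"
  have a: "a = k + c * r"
    by (simp add: k_def)
  \<comment> \<open>The determinant factors as (a - c r) (c r + d), and k is the first
    factor.\<close>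
  have "k \<noteq> 0"
    using det by (auto simp: b a algebra_simps)
  have xr: "x - h r \<noteq> 0" and yr: "y - h r \<noteq> 0"
    using x y by auto
  have hb: "h b = h c * h r * h r + (h d - h k - h c * h r) * h r"
    using arg_cong[OF b, of h] by (simp add: a algebra_simps)
  have "(y - h r) * (h c * x + h d) = h a * x + h b - h r * (h c * x + h d)"
    by (simp only: left_diff_distrib eq)
  also have "\<dots> = h k * (x - h r)"
    by (simp add: hb a algebra_simps)
  finally have "(y - h r) * (h c * (x - h r) + h (c * r + d)) = h k * (x - h r)"
    by (simp add: algebra_simps)
  then have "inverse (y - h r) * h k = h c + h (c * r + d) * inverse (x - h r)"
    using xr yr by (simp add: field_simps)
  then have "inverse (y - h r) = (h c + h (c * r + d) * inverse (x - h r)) / h k"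
    using \<open>k \<noteq> 0\<close> by (metis hom_eq_0_iff nonzero_mult_div_cancel_right)
  also have "\<dots> = h ((c * r + d) / k) * inverse (x - h r) + h (c / k)"
    by (simp add: add_divide_distrib distrib_right)
  finally have "inverse (y - h r) = h ((c * r + d) / k) * inverse (x - h r) + h (c / k)" .
  then show thesis
    using that by blast
qed

end

text \<open>The monodromy group acting on \<open>S\<close> = C(x), in abstract form. Its elements
  are controlled only on \<open>S\<close>, so \<open>G\<close> is a set of maps closed under
  composition up to agreement on \<open>S\<close>.\<close>

locale commuting_moebius = constant_field h for h :: "'c::alg_closed_field \<Rightarrow> 'o::field" +
  fixes S :: "'o set" and G :: "('o \<Rightarrow> 'o) set" and x :: 'o and p :: nat
  assumes S: "subfield_set S" "range h \<subseteq> S" "x \<in> S" and x: "x \<notin> range h" and p: "p > 0"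
    and G_in: "\<sigma> \<in> G \<Longrightarrow> u \<in> S \<Longrightarrow> \<sigma> u \<in> S"
    and G_add: "\<sigma> \<in> G \<Longrightarrow> u \<in> S \<Longrightarrow> v \<in> S \<Longrightarrow> \<sigma> (u + v) = \<sigma> u + \<sigma> v"
    and G_mult: "\<sigma> \<in> G \<Longrightarrow> u \<in> S \<Longrightarrow> v \<in> S \<Longrightarrow> \<sigma> (u * v) = \<sigma> u * \<sigma> v"
    and G_const: "\<sigma> \<in> G \<Longrightarrow> \<sigma> (h e) = h e"
    and G_moebius: "\<sigma> \<in> G \<Longrightarrow> moebius_related h x (\<sigma> x)"
    and G_comm: "\<sigma> \<in> G \<Longrightarrow> \<tau> \<in> G \<Longrightarrow> u \<in> S \<Longrightarrow> \<sigma> (\<tau> u) = \<tau> (\<sigma> u)"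
    and G_comp: "\<sigma> \<in> G \<Longrightarrow> \<tau> \<in> G \<Longrightarrow> \<exists>\<rho>\<in>G. \<forall>u\<in>S. \<rho> u = \<sigma> (\<tau> u)"
    and G_exp: "\<sigma> \<in> G \<Longrightarrow> u \<in> S \<Longrightarrow> (\<sigma> ^^ p) u = u"
begin

lemma hS [simp]: "h c \<in> S"
  using S(2) by blast

lemma SI: "u \<in> S \<Longrightarrow> v \<in> S \<Longrightarrow> u + v \<in> S" "u \<in> S \<Longrightarrow> v \<in> S \<Longrightarrow> u * v \<in> S"
  "u \<in> S \<Longrightarrow> v \<in> S \<Longrightarrow> u - v \<in> S" "u \<in> S \<Longrightarrow> inverse u \<in> S"
  using subfield_setD[OF S(1)] by auto

lemma G_linear: "\<sigma> \<in> G \<Longrightarrow> u \<in> S \<Longrightarrow> \<sigma> (h a * u + h b) = h a * \<sigma> u + h b"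
  by (simp add: G_add G_mult G_const SI)

lemma G_diff: "\<sigma> \<in> G \<Longrightarrow> u \<in> S \<Longrightarrow> \<sigma> (u - h b) = \<sigma> u - h b"
  using G_linear[of \<sigma> u 1 "- b"] by simp

lemma G_nonzero: "\<sigma> \<in> G \<Longrightarrow> u \<in> S \<Longrightarrow> u \<noteq> 0 \<Longrightarrow> \<sigma> u \<noteq> 0"
  using G_mult[of \<sigma> u "inverse u"] G_const[of \<sigma> 1] SI(4)[of u] by auto

lemma G_inverse:
  assumes "\<sigma> \<in> G" "u \<in> S"
  shows "\<sigma> (inverse u) = inverse (\<sigma> u)"
proof (cases "u = 0")
  case True
  then show ?thesis using G_const[OF assms(1), of 0] by simp
next
  case False
  then have "\<sigma> u * \<sigma> (inverse u) = 1"
    using G_mult[OF assms(1,2) SI(4)[OF assms(2)]] G_const[OF assms(1), of 1] by simp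
  then show ?thesis
    by (simp add: inverse_unique)
qed

lemma G_moebius_hom:
  assumes "\<sigma> \<in> G" "u \<in> S" "v \<in> S" "v * (h c * u + h d) = h a * u + h b"
  shows "\<sigma> v * (h c * \<sigma> u + h d) = h a * \<sigma> u + h b"
  using arg_cong[OF assms(4), of \<sigma>] assms(1-3) by (simp add: G_mult G_linear SI)

lemma G_moebius_related:
  assumes "\<sigma> \<in> G" "u \<in> S" "v \<in> S" "moebius_related h u v"
  shows "moebius_related h (\<sigma> u) (\<sigma> v)"
  using assms G_moebius_hom[OF assms(1-3)] unfolding moebius_related_def by blast

text \<open>Moving a fixed point to infinity makes \<sigma> affine. A nontrivial translation has
  infinite order in characteristic zero, against the exponent p; so there is a second fixed point,
  which is moved to 0.\<close>

lemma scaling_coordinate: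
  assumes \<sigma>: "\<sigma> \<in> G" "\<sigma> x \<noteq> x"
  obtains u \<alpha> where "u \<in> S" "moebius_related h x u" "\<sigma> u = h \<alpha> * u" "\<alpha> \<noteq> 0" "\<alpha> \<noteq> 1"
proof -
  obtain v \<alpha> \<beta> where v: "v \<in> S" "moebius_related h x v" "\<sigma> v = h \<alpha> * v + h \<beta>"
  proof -
    obtain a b c d where 1: "a * d \<noteq> b * c" "\<sigma> x * (h c * x + h d) = h a * x + h b"
      using G_moebius[OF \<sigma>(1)] by (auto simp: moebius_related_def)
    show thesis
    proof (cases "c = 0")
      case True
      with 1 have "d \<noteq> 0" by auto
      then have "\<sigma> x = h (a / d) * x + h (b / d)"
        using 1 True by (simp add: field_simps)
      then show thesis
        using that S(3) moebius_related_refl by blast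
    next
      case False
      obtain r \<alpha> \<beta> where *: "inverse (\<sigma> x - h r) = h \<alpha> * inverse (x - h r) + h \<beta>"
        using affine_coordinate[OF x moebius_related_not_const[OF G_moebius[OF \<sigma>(1)] x] 1 False] by blast
      have "x - h r \<noteq> 0"
        using x by auto
      then have "(0::'c) * (- r) \<noteq> 1 * 1 \<and> inverse (x - h r) * (h 1 * x + h (- r)) = h 0 * x + h 1"
        by simp
      then have "moebius_related h x (inverse (x - h r))"
        unfolding moebius_related_def by blast
      moreover have "inverse (x - h r) \<in> S"
        using S(3) by (intro SI) auto
      moreover have "\<sigma> (inverse (x - h r)) = h \<alpha> * inverse (x - h r) + h \<beta>"
        using * S(3) \<sigma>(1) by (simp add: G_inverse G_diff SI)
      ultimately show thesis
        using that by blast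
    qed
  qed
  have vc: "v \<notin> range h"
    using moebius_related_not_const v(2) x by blast
  \<comment> \<open>x is a Moebius transform of v with constant coefficients, so fixing v would fix
    x.\<close>
  have "\<sigma> v \<noteq> v"
  proof
    assume fix_v: "\<sigma> v = v"
    obtain a b c d where 1: "a * d \<noteq> b * c" "x * (h c * v + h d) = h a * v + h b"
      using moebius_related_sym[OF v(2)] by (auto simp: moebius_related_def)
    have "\<sigma> x * (h c * v + h d) = h a * v + h b"
      using G_moebius_hom[OF \<sigma>(1) v(1) S(3) 1(2)] fix_v by simp
    then have "(\<sigma> x - x) * (h c * v + h d) = 0"
      using 1(2) by (simp add: left_diff_distrib)
    then have "h c * v + h d = 0"
      using \<sigma>(2) by simp
    with linear_zero[OF vc this] 1(1) show False by simp
  qed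
  have "\<alpha> \<noteq> 1"
  proof
    assume "\<alpha> = 1"
    then have step: "\<sigma> v = v + h \<beta>"
      using v by simp
    have "(\<sigma> ^^ n) v = v + h (of_nat n * \<beta>)" for n
    proof (induction n)
      case (Suc n)
      then show ?case
        using \<sigma>(1) v(1) G_add[OF \<sigma>(1) v(1) hS[of "of_nat n * \<beta>"]] G_const[OF \<sigma>(1)]
        by (simp add: step algebra_simps del: hom_mult)
    qed simp
    from this[of p] have "h (of_nat p * \<beta>) = 0"
      using G_exp[OF \<sigma>(1) v(1)] by simp
    then have "of_nat p * \<beta> = 0"
      by (simp only: hom_eq_0_iff)
    then have "\<beta> = 0"
      using char0[OF p] by simp
    with step \<open>\<sigma> v \<noteq> v\<close> show False by simp
  qed
  \<comment> \<open>The finite fixed point of v \<mapsto> \<alpha> v + \<beta>.\<close>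
  define e where "e = \<beta> / (1 - \<alpha>)"
  have \<beta>: "\<beta> = e - \<alpha> * e"
  proof -
    have "e * (1 - \<alpha>) = \<beta>"
      using \<open>\<alpha> \<noteq> 1\<close> by (simp add: e_def)
    then show ?thesis
      by (simp add: algebra_simps)
  qed
  define u where "u = v - h e"
  have uS: "u \<in> S"
    using v(1) by (simp add: u_def SI)
  have \<sigma>u: "\<sigma> u = h \<alpha> * u"
    using v \<sigma>(1) by (simp add: u_def G_diff \<beta> algebra_simps)
  have "(1::'c) * 1 \<noteq> (- e) * 0 \<and> u * (h 0 * v + h 1) = h 1 * v + h (- e)"
    by (simp add: u_def)
  then have "moebius_related h v u"
    unfolding moebius_related_def by blast
  then have "moebius_related h x u"
    using moebius_related_trans v(2) x by blast
  moreover have "\<alpha> \<noteq> 0"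
  proof
    assume "\<alpha> = 0"
    then have "\<sigma> u = 0" using \<sigma>u by simp
    moreover have "u \<noteq> 0" using vc by (auto simp: u_def)
    ultimately show False using G_nonzero[OF \<sigma>(1) uS] by simp
  qed
  ultimately show thesis
    using that uS \<sigma>u \<open>\<alpha> \<noteq> 1\<close> by blast
qed

lemma scaling_power:
  assumes "\<tau> \<in> G" "u \<in> S" "u \<noteq> 0" "\<tau> u = h \<kappa> * u"
  shows "\<kappa> ^ p = 1"
proof -
  have "(\<tau> ^^ n) u = h (\<kappa> ^ n) * u" for n
    by (induction n) (use assms in \<open>simp_all add: G_mult G_const flip: hom_power\<close>)
  then have "h (\<kappa> ^ p) * u = h 1 * u"
    using G_exp[OF assms(1,2)] by simp
  then have "h (\<kappa> ^ p) = h 1"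
    using assms(3) by (simp del: hom_power hom_one)
  then show ?thesis
    by (simp only: hom_inject)
qed

text \<open>A Moebius transformation commuting with \<open>u \<mapsto> \<alpha> u\<close> permutes its fixed points \<open>0\<close> and \<open>\<infinity>\<close>.\<close>
lemma commuting_with_scaling:
  assumes \<sigma>: "\<sigma> \<in> G" "\<sigma> u = h \<alpha> * u" "\<alpha> \<noteq> 0" "\<alpha> \<noteq> 1"
    and u: "u \<in> S" "u \<notin> range h" and \<tau>: "\<tau> \<in> G" "moebius_related h u (\<tau> u)"
  obtains \<kappa> where "\<tau> u = h \<kappa> * u" | \<mu> where "\<mu> \<noteq> 0" "\<tau> u = h \<mu> / u"
proof -
  obtain a b c d where det: "a * d \<noteq> b * c" and eq: "\<tau> u * (h c * u + h d) = h a * u + h b"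
    using \<tau>(2) by (auto simp: moebius_related_def)
  have u0: "u \<noteq> 0"
    using u(2) hom_zero by (metis rangeI)
  have "\<sigma> (\<tau> u) = h \<alpha> * \<tau> u"
    using G_comm[OF \<sigma>(1) \<tau>(1) u(1)] \<sigma>(2) u(1) \<tau>(1) by (simp add: G_mult G_const)
  then have "h \<alpha> * \<tau> u * (h c * (h \<alpha> * u) + h d) = h a * (h \<alpha> * u) + h b"
    using G_moebius_hom[OF \<sigma>(1) u(1) G_in[OF \<tau>(1) u(1)] eq] \<sigma>(2) by simp
  then have "h \<alpha> * (\<tau> u * (h c * u + h d)) * (h c * (h \<alpha> * u) + h d) = (h a * (h \<alpha> * u) + h b) * (h c * u + h d)"
    by (simp add: mult_ac)
  then have quad: "h \<alpha> * (h a * u + h b) * (h c * (h \<alpha> * u) + h d) = (h a * (h \<alpha> * u) + h b) * (h c * u + h d)"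
    unfolding eq .
  \<comment> \<open>The expanded difference of the two sides of \<open>quad\<close>; transcendence
    of u makes all coefficients vanish. The outer ones give b d = 0 and a c = 0. The middle one
    carries \<alpha>^2 - 1, which is 0 for \<alpha> = -1, the case in which inversions
    survive.\<close>
  define q where "q = [:(\<alpha> - 1) * b * d, (\<alpha> * \<alpha> - 1) * b * c, \<alpha> * (\<alpha> - 1) * a * c:]"
  have "poly (map_poly h q) u = 0"
    using quad by (simp add: q_def algebra_simps)
  moreover have "transcendental_over h u"
    using u(2) by (simp add: transcendental_over_iff[OF field_hom_axioms])
  ultimately have "q = 0"
    by (auto simp: transcendental_over_def)
  then have bd: "b * d = 0" and ac: "a * c = 0"
    using \<sigma>(3,4) by (auto simp: q_def)
  show thesis
  proof (cases "a = 0")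
    case True
    then have "b \<noteq> 0" "c \<noteq> 0" "d = 0"
      using det bd by auto
    then have "\<tau> u = h (b / c) / u" "b / c \<noteq> 0"
      using eq True u0 by (auto simp: field_simps)
    then show thesis using that(2) by blast
  next
    case False
    then have "c = 0" "d \<noteq> 0" "b = 0"
      using det ac bd by auto
    then have "\<tau> u = h (a / d) * u"
      using eq by (simp add: field_simps)
    then show thesis using that(1) by blast
  qed
qed

theorem orbit_bound: "finite ((\<lambda>\<sigma>. \<sigma> x) ` G)" "card ((\<lambda>\<sigma>. \<sigma> x) ` G) \<le> 2 * p"
proof -
  have "finite ((\<lambda>\<sigma>. \<sigma> x) ` G) \<and> card ((\<lambda>\<sigma>. \<sigma> x) ` G) \<le> 2 * p"
  proof (cases "\<forall>\<sigma>\<in>G. \<sigma> x = x")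
    case True
    then have sub: "(\<lambda>\<sigma>. \<sigma> x) ` G \<subseteq> {x}" by auto
    then have "card ((\<lambda>\<sigma>. \<sigma> x) ` G) \<le> card {x}"
      by (intro card_mono) auto
    with sub p show ?thesis
      using finite_subset[OF sub] by simp
  next
    case False
    then obtain \<sigma> where \<sigma>: "\<sigma> \<in> G" "\<sigma> x \<noteq> x" by blast
    obtain u \<alpha> where u: "u \<in> S" "moebius_related h x u" and \<alpha>: "\<sigma> u = h \<alpha> * u" "\<alpha> \<noteq> 0" "\<alpha> \<noteq> 1"
      using scaling_coordinate[OF \<sigma>] by blast
    have uc: "u \<notin> range h"
      using moebius_related_not_const u(2) x by blast
    then have u0: "u \<noteq> 0"
      using hom_zero by (metis rangeI)
    have \<tau>u: "moebius_related h u (\<tau> u)" if "\<tau> \<in> G" for \<tau>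
    proof -
      have "moebius_related h x (\<tau> u)"
        using moebius_related_trans[OF G_moebius[OF that] G_moebius_related[OF that S(3) u] x] .
      then show ?thesis
        using moebius_related_trans[OF moebius_related_sym[OF u(2)] _ uc] by blast
    qed
    have cases: "(\<exists>\<kappa>. \<tau> u = h \<kappa> * u) \<or> (\<exists>\<mu>. \<mu> \<noteq> 0 \<and> \<tau> u = h \<mu> / u)" if "\<tau> \<in> G" for \<tau>
      using commuting_with_scaling[OF \<sigma>(1) \<alpha> u(1) uc that \<tau>u[OF that]] by metis
    \<comment> \<open>Two inversions compose to the scaling by \<mu>' / \<mu>, and the exponent
      makes this factor a p-th root of unity.\<close>
    have inversion_power: "\<mu> ^ p = \<mu>' ^ p"
      if 1: "\<tau> \<in> G" "\<tau> u = h \<mu> / u" "\<mu> \<noteq> 0" and 2: "\<tau>' \<in> G" "\<tau>' u = h \<mu>' / u" for \<tau> \<tau>' \<mu> \<mu>'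
    proof -
      obtain \<rho> where \<rho>: "\<rho> \<in> G" "\<forall>u\<in>S. \<rho> u = \<tau> (\<tau>' u)"
        using G_comp[OF 1(1) 2(1)] by blast
      have "\<rho> u = \<tau> (h \<mu>' * inverse u)"
        using \<rho>(2) u(1) 2(2) by (simp add: divide_inverse)
      also have "\<dots> = h \<mu>' * inverse (\<tau> u)"
        using 1(1) u(1) by (simp add: G_mult G_const G_inverse SI)
      also have "\<dots> = h (\<mu>' / \<mu>) * u"
        unfolding 1(2) using 1(3) u0 by simp
      finally have "(\<mu>' / \<mu>) ^ p = 1"
        using scaling_power[OF \<rho>(1) u(1) u0] by blast
      then show ?thesis
        using 1(3) by (simp add: power_divide)
    qed
    \<comment> \<open>\<nu> is the common p-th power of the inversion parameters, and arbitrary if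
      there is no inversion.\<close>
    obtain \<nu> where \<nu>: "\<And>\<tau> \<mu>. \<tau> \<in> G \<Longrightarrow> \<tau> u = h \<mu> / u \<Longrightarrow> \<mu> \<noteq> 0 \<Longrightarrow> \<mu> ^ p = \<nu>"
      using inversion_power by metis
    let ?A = "(\<lambda>\<kappa>. h \<kappa> * u) ` {\<kappa>. \<kappa> ^ p = 1} \<union> (\<lambda>\<mu>. h \<mu> / u) ` {\<mu>. \<mu> ^ p = \<nu>}"
    have sub: "(\<lambda>\<tau>. \<tau> u) ` G \<subseteq> ?A"
      using cases scaling_power[OF _ u(1) u0] \<nu> by blast
    have fin: "finite ?A"
      using card_power_roots(1)[OF p] by (intro finite_UnI finite_imageI)
    have "card ?A \<le> card ((\<lambda>\<kappa>. h \<kappa> * u) ` {\<kappa>. \<kappa> ^ p = 1}) + card ((\<lambda>\<mu>. h \<mu> / u) ` {\<mu>. \<mu> ^ p = \<nu>})"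
      by (rule card_Un_le)
    also have "\<dots> \<le> p + p"
      using card_power_roots[OF p] card_image_le
      by (intro add_mono order.trans[OF card_image_le]) auto
    finally have card_A: "card ?A \<le> 2 * p" by simp
    obtain a b c d where det: "a * d \<noteq> b * c" and eq: "x * (h c * u + h d) = h a * u + h b"
      using moebius_related_sym[OF u(2)] by (auto simp: moebius_related_def)
    \<comment> \<open>x is a Moebius function F of u with constant coefficients, so \<tau> x = F
      (\<tau> u), and the bound for the images of u passes to those of x.\<close>
    define F where "F w = (h a * w + h b) / (h c * w + h d)" for w
    have "\<tau> x = F (\<tau> u)" if "\<tau> \<in> G" for \<tau>
    proof -
      have "h c * \<tau> u + h d \<noteq> 0"
        using linear_zero[OF moebius_related_not_const[OF \<tau>u[OF that] uc]] det
        by (metis mult_zero_right)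
      then show ?thesis
        using G_moebius_hom[OF that u(1) S(3) eq] by (simp add: F_def field_simps)
    qed
    then have "(\<lambda>\<tau>. \<tau> x) ` G \<subseteq> F ` ?A"
      using sub by blast
    then show ?thesis
      using fin card_A card_image_le[OF fin, of F] card_mono[of "F ` ?A"] finite_subset
      by (meson finite_imageI order.trans)
  qed
  then show "finite ((\<lambda>\<sigma>. \<sigma> x) ` G)" "card ((\<lambda>\<sigma>. \<sigma> x) ` G) \<le> 2 * p"
    by auto
qed

end

text \<open>Carries roots from the ring record, where polynomials are coefficient lists, over to
  \<open>poly\<close>.\<close>

lemma algebraically_closed_poly_root:
  fixes p :: "'a::field poly"
  assumes "algebraically_closed (ring_of_type_algebra :: 'a ring)" "degree p > 0"
  shows "\<exists>x. poly p x = 0"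
proof -
  let ?R = "ring_of_type_algebra :: 'a ring"
  interpret R: algebraically_closed ?R by fact
  have ops: "\<one>\<^bsub>?R\<^esub> = 1" "\<zero>\<^bsub>?R\<^esub> = 0" "add ?R = (+)" "monoid.mult ?R = (*)" "carrier ?R = UNIV"
    by (auto simp: ring_of_type_algebra_def)
  have pow: "x [^]\<^bsub>?R\<^esub> n = x ^ n" for x :: 'a and n :: nat
    by (induction n) (simp_all add: ops mult.commute)
  have eval: "R.eval xs x = poly (Poly (rev xs)) x" for xs x
    by (induction xs) (simp_all add: ops pow Poly_append poly_monom)
  \<comment> \<open>Coefficient lists over the ring record begin with the leading coefficient,
    whereas \<open>coeffs\<close> ends with it.\<close>
  define P where "P = rev (coeffs p)"
  have "p \<noteq> 0"
    using assms(2) by auto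
  then have "P \<in> carrier (poly_ring ?R)"
    by (auto simp: P_def univ_poly_def polynomial_def ops hd_rev last_coeffs_eq_coeff_degree)
  moreover from this have "R.splitted P"
    by (rule R.roots_over_carrier)
  moreover have "Polynomials.degree P = degree p"
    by (simp add: P_def degree_eq_length_coeffs)
  ultimately have "R.roots P \<noteq> {#}" 
    using assms(2) unfolding R.splitted_def by auto
  then obtain x where "x \<in># R.roots P"
    by blast
  then have "R.is_root P x"
    using R.roots_mem_iff_is_root[OF \<open>P \<in> _\<close>] by simp
  then have "poly (Poly (rev P)) x = 0"
    by (simp add: R.is_root_def eval ops)
  then show ?thesis
    by (auto simp: P_def)
qed

section \<open>Backward orbits of additive polynomials\<close>

text \<open>A polynomial vanishing on the infinite set \<open>range h\<close> is zero. This is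
  applied twice: with the first argument a constant and the second varying, then with the second
  arbitrary and the first varying.\<close>

lemma additive_poly_extension:
  fixes f :: "'a::field poly"
  assumes "field_hom h" and inf: "infinite (UNIV :: 'a set)" and f: "additive_poly f"
  shows "poly (map_poly h f) (x + y) = poly (map_poly h f) x + poly (map_poly h f) y"
proof -
  interpret field_hom h by fact
  have infh: "infinite (range h)"
    using inf finite_imageD[of h UNIV] by (auto simp: inj_on_def)
  have zero: "q = 0" if "\<And>a. poly q (h a) = 0" for q
  proof (rule ccontr)
    assume "q \<noteq> 0"
    then have "finite {x. poly q x = 0}"
      by (rule poly_roots_finite)
    moreover have "range h \<subseteq> {x. poly q x = 0}"
      using that by auto
    ultimately show False
      using infh finite_subset by blast
  qed
  let ?F = "map_poly h f"
  have 1: "poly ?F (h a + y) = poly ?F (h a) + poly ?F y" for a y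
  proof -
    define q where "q = pcompose ?F [:h a, 1:] - ?F - [:poly ?F (h a):]"
    have "poly q (h b) = 0" for b
    proof -
      have "poly ?F (h a + h b) = poly ?F (h a) + poly ?F (h b)"
        using f by (metis additive_poly_def hom_add poly_map)
      then show ?thesis
        by (simp add: q_def poly_pcompose)
    qed
    from arg_cong[OF zero[OF this], of "\<lambda>q. poly q y"] show ?thesis
      by (simp add: q_def poly_pcompose algebra_simps)
  qed
  define q where "q = pcompose ?F [:y, 1:] - ?F - [:poly ?F y:]"
  have "poly q (h a) = 0" for a
    using 1[of a y] by (simp add: q_def poly_pcompose add.commute)
  from arg_cong[OF zero[OF this], of "\<lambda>q. poly q x"] show ?thesis
    by (simp add: q_def poly_pcompose algebra_simps)
qed

text \<open>The chosen coprime representation can differ from f / 1 only by a unit, which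
  cancels.\<close>

lemma rat_map_frac_of: "rat_map (frac_of f) w = poly (map_poly geom_const f) w"
proof -
  obtain P Q where PQ: "lowest_terms (frac_of f) = (P, Q)" "Q \<noteq> 0" "coprime P Q"
    and eq: "frac_of f = Fraction_Field.Fract P Q"
    using lowest_terms by blast
  then have P: "P = f * Q"
    by (simp add: frac_of_def eq_fract)
  then have "is_unit Q"
    using PQ(3) by (meson coprime_common_divisor dvd_refl dvd_triv_right)
  then have "degree Q = 0"
    using PQ(2) by (simp add: is_unit_iff_degree)
  then obtain c where "Q = [:c:]"
    using degree_eq_zeroE by blast
  then show ?thesis
    using PQ(1,2) by (simp add: rat_eval_def P)
qed

locale additive_separable =
  fixes f :: "'k::field poly" and p :: nat
  assumes f: "additive_poly f" "rsquarefree f" "2 \<le> degree f"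
    and inf: "infinite (UNIV :: 'k set)" and char: "CHAR('k) = p"
begin

abbreviation F :: "'k geom \<Rightarrow> 'k geom" where
  "F \<equiv> rat_map (frac_of f)"

lemma F_add: "F (x + y) = F x + F y"
  unfolding rat_map_frac_of by (rule additive_poly_extension[OF geom_const.field_hom_axioms inf f(1)])

lemma F_iter_add: "(F ^^ n) (x + y) = (F ^^ n) x + (F ^^ n) y"
  by (induction n) (simp_all add: F_add)

lemma F_iter_0 [simp]: "(F ^^ n) 0 = 0"
  by (metis add.right_neutral add_left_cancel F_iter_add)

lemma F_iter_diff: "(F ^^ n) (x - y) = (F ^^ n) x - (F ^^ n) y"
  using F_iter_add[of n "x - y" y] by simp

lemma F_surj: "\<exists>w. F w = z"
proof -
  have "degree (map_poly geom_const f - [:z:]) > 0"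
    using f(3) by (simp add: diff_conv_add_uminus degree_add_eq_left del: add_uminus_conv_diff)
  then obtain w where "poly (map_poly geom_const f - [:z:]) w = 0"
    using alg_closed_imp_poly_has_root by blast
  then show ?thesis
    by (auto simp: rat_map_frac_of)
qed

text \<open>A preimage of a constant is a root of a nonzero polynomial over C, and C is
  algebraically closed.\<close>

lemma F_const_iff: "F d \<in> range closure_const \<longleftrightarrow> d \<in> range closure_const"
proof
  assume "F d \<in> range closure_const"
  then obtain c where c: "F d = closure_const c" by blast
  define q where "q = map_poly to_ac f - [:c:]"
  have "degree q > 0"
    using f(3) by (simp add: q_def diff_conv_add_uminus degree_add_eq_left del: add_uminus_conv_diff)
  then have "q \<noteq> 0" by auto
  moreover have "poly (map_poly closure_const q) d = 0"
    using c by (simp add: q_def rat_map_frac_of map_poly_geom_const)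
  ultimately show "d \<in> range closure_const"
    using field_hom_eval.poly_nonzero[OF field_hom_eval_closure_const] by blast
qed (rule rat_map_const)

lemma F_iter_const_iff: "(F ^^ n) d \<in> range closure_const \<longleftrightarrow> d \<in> range closure_const"
  by (induction n) (simp_all add: F_const_iff)

lemma preimages_iff: "x \<in> preimages_T n (frac_of f) \<longleftrightarrow> (F ^^ n) x = geom_T"
  using F_iter_const_iff[of n x] geom_T_not_const unfolding preimages_T_iff by metis

text \<open>x and \<sigma> x lie over T at the same level, so their difference is in the kernel of
  the n-th iterate, and this kernel consists of constants.\<close>

lemma geom_IMG_translation:
  assumes "\<sigma> \<in> carrier (geom_IMG (frac_of f))" "x \<in> backward_orbit (frac_of f)"
  obtains c where "\<sigma> x = x + closure_const c"
proof -
  obtain n where n: "n \<ge> 1" "x \<in> preimages_T n (frac_of f)"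
    using assms(2) by (auto simp: backward_orbit_def)
  have "(F ^^ n) (\<sigma> x - x) = closure_const 0"
    using n(2) geom_IMG_preserves_preimages[OF assms(1) n(2,1)]
    by (simp add: F_iter_diff preimages_iff)
  then have "\<sigma> x - x \<in> range closure_const"
    using F_iter_const_iff by (metis rangeI)
  then show thesis
    using that by (auto simp: algebra_simps)
qed

lemma geom_IMG_add_const:
  assumes "\<sigma> \<in> carrier (geom_IMG (frac_of f))" "x \<in> backward_orbit (frac_of f)"
  shows "\<sigma> (x + closure_const c) = \<sigma> x + closure_const c"
proof -
  have "x \<in> K_infinity (frac_of f)" "closure_const c \<in> K_infinity (frac_of f)"
    using assms(2) subsetD[OF backward_orbit_subset_K_infinity]
      subsetD[OF geom_base_subset_K_infinity closure_const_in_geom_base] by auto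
  then show ?thesis
    using assms(1) closure_const_in_geom_base[of c] by (simp add: geom_IMG_iff)
qed

lemma geom_IMG_commute:
  assumes "\<sigma> \<in> carrier (geom_IMG (frac_of f))" "\<tau> \<in> carrier (geom_IMG (frac_of f))"
    "x \<in> backward_orbit (frac_of f)"
  shows "\<sigma> (\<tau> x) = \<tau> (\<sigma> x)"
proof -
  obtain c d where "\<sigma> x = x + closure_const c" "\<tau> x = x + closure_const d"
    using geom_IMG_translation assms by metis
  then show ?thesis
    using assms by (simp add: geom_IMG_add_const algebra_simps)
qed

lemma geom_IMG_exponent:
  assumes "\<sigma> \<in> carrier (geom_IMG (frac_of f))" "x \<in> backward_orbit (frac_of f)"
  shows "(\<sigma> ^^ p) x = x"
proof -
  obtain c where c: "\<sigma> x = x + closure_const c"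
    using geom_IMG_translation assms by metis
  have "(\<sigma> ^^ n) x = x + closure_const (of_nat n * c)" for n
  proof (induction n)
    case (Suc n)
    then show ?case
      using geom_IMG_add_const[OF assms] by (simp add: c algebra_simps del: closure_const.hom_mult closure_const.hom_add)
        (simp add: algebra_simps)
  qed simp
  from this[of p] show ?thesis
    using of_nat_CHAR[where ?'a = "'k alg_closure"]
    by (simp only: CHAR_alg_closure char mult_zero_left closure_const.hom_zero add_0_right)
qed

text \<open>The root 0 is simple by separability while the degree is at least 2, so another root
  remains. For the inseparable z^p the kernel is trivial.\<close>

lemma kernel_nontrivial: "\<exists>b. b \<noteq> 0 \<and> F b = 0"
proof -
  have "poly f 0 = 0"
    using f(1) by (metis add.right_neutral add_left_cancel additive_poly_def)
  then obtain q where q: "f = [:0, 1:] * q"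
    by (metis dvdE minus_zero poly_eq_0_iff_dvd)
  have f0: "f \<noteq> 0"
    using f(3) by auto
  have "poly q 0 \<noteq> 0"
  proof
    assume "poly q 0 = 0"
    then obtain q' where "q = [:0, 1:] * q'"
      by (metis dvdE minus_zero poly_eq_0_iff_dvd)
    then have "f = [:- 0, 1:] ^ 2 * q'"
      by (simp add: q power2_eq_square)
    then have "[:- 0, 1:] ^ 2 dvd f"
      by (rule dvdI)
    then have "order 0 f \<ge> 2"
      using f0 order_divides[of 0 2 f] by simp
    then show False
      using f(2) by (metis numeral_le_one_iff rsquarefree_def semiring_norm(69) not_numeral_le_zero)
  qed
  have "q \<noteq> 0"
    using f0 q by auto
  then have "degree f = Suc (degree q)"
    unfolding q by (subst degree_mult_eq) auto
  then have "degree (map_poly geom_const q) > 0"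
    using f(3) by simp
  then obtain b where b: "poly (map_poly geom_const q) b = 0"
    using alg_closed_imp_poly_has_root by blast
  have "poly (map_poly geom_const q) 0 = geom_const (poly q 0)"
    using geom_const.poly_map[of q 0] by simp
  with b \<open>poly q 0 \<noteq> 0\<close> have "b \<noteq> 0"
    by auto
  moreover have "F b = 0"
    using b by (simp add: rat_map_frac_of q)
  ultimately show ?thesis by blast
qed

text \<open>The b i form a chain of successive preimages of a nonzero kernel element b 0. The
  iterate i + 1 kills b i but sends every later b j to a nonzero member of the chain, so all are
  distinct.\<close>

lemma iterate_kernels_infinite:
  obtains b where "inj b" "\<And>i n. i < n \<Longrightarrow> (F ^^ n) (b i) = 0"
proof -
  obtain b0 where b0: "b0 \<noteq> 0" "F b0 = 0"
    using kernel_nontrivial by blast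
  define lift where "lift z = (SOME w. F w = z)" for z
  have lift: "F (lift z) = z" for z
    unfolding lift_def using F_surj by (rule someI_ex)
  have F_iter_lift: "(F ^^ n) ((lift ^^ (n + m)) z) = (lift ^^ m) z" for n m z
  proof (induction n)
    case (Suc n)
    have "(F ^^ Suc n) w = (F ^^ n) (F w)" for w
      by (simp add: funpow_swap1)
    then show ?case
      using Suc by (simp add: lift del: funpow.simps(2)) (simp add: lift)
  qed simp
  define b where "b i = (lift ^^ i) b0" for i
  have b_nonzero: "b i \<noteq> 0" for i
    using F_iter_lift[of i 0 b0] b0(1) by (auto simp: b_def)
  have b_kernel: "(F ^^ n) (b i) = 0" if less: "i < n" for i n
  proof -
    obtain m where "n = m + Suc i"
      using less by (metis add.commute add_Suc_right less_iff_Suc_add)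
    then have "(F ^^ n) (b i) = (F ^^ m) (F ((F ^^ i) ((lift ^^ (i + 0)) b0)))"
      by (simp add: funpow_add b_def funpow_swap1)
    also have "\<dots> = 0"
      unfolding F_iter_lift by (simp add: b0)
    finally show ?thesis .
  qed
  have "b i \<noteq> b j" if less: "i < j" for i j
  proof
    assume "b i = b j"
    obtain m where "j = Suc i + m"
      using less by (metis add_Suc_right add_Suc less_iff_Suc_add)
    then have "(F ^^ Suc i) (b j) = b m"
      using F_iter_lift[of "Suc i" m b0] by (simp only: b_def)
    moreover have "(F ^^ Suc i) (b i) = 0"
      by (rule b_kernel) simp
    ultimately show False
      using b_nonzero[of m] \<open>b i = b j\<close> by metis
  qed
  then have "inj b"
    by (metis injI linorder_neqE_nat)
  with that b_kernel show thesis by blast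
qed

text \<open>The translates of one point by b 0, ..., b (n - 1) suffice: linear growth with the level
  beats a bound independent of the level.\<close>

lemma preimages_large:
  obtains A x where "finite A" "card A = n" "A \<subseteq> preimages_T n (frac_of f)" "x \<in> preimages_T n (frac_of f)"
proof -
  obtain b where b: "inj b" "\<And>i n. i < n \<Longrightarrow> (F ^^ n) (b i) = 0"
    using iterate_kernels_infinite by blast
  have "\<exists>x. (F ^^ n) x = z" for z
  proof (induction n arbitrary: z)
    case (Suc n)
    obtain w where "F w = z" using F_surj by blast
    moreover obtain x where "(F ^^ n) x = w" using Suc by blast
    ultimately show ?case by auto
  qed auto
  then obtain x where x: "(F ^^ n) x = geom_T" by blast
  let ?A = "(\<lambda>i. x + b i) ` {..<n}"
  have "card ?A = n"
    using b(1) by (subst card_image) (auto simp: inj_on_def inj_def)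
  moreover have "?A \<subseteq> preimages_T n (frac_of f)"
    using x b(2) by (auto simp: preimages_iff F_iter_add)
  ultimately show thesis
    using that[of ?A x] x by (simp add: preimages_iff)
qed

end

section \<open>Commuting monodromy in characteristic zero\<close>

lemma K_infinity_contains_const_adjoin:
  assumes "x \<in> backward_orbit g"
  shows "const_adjoin x \<subseteq> K_infinity g"
proof -
  note K = subfield_set_K_infinity[of g]
  have c: "closure_const c \<in> K_infinity g" for c
    by (rule subsetD[OF geom_base_subset_K_infinity closure_const_in_geom_base])
  have x: "x \<in> K_infinity g"
    using assms backward_orbit_subset_K_infinity by blast
  have "poly (map_poly closure_const P) x \<in> K_infinity g" for P
    by (rule poly_in_subfield_set[OF K _ x]) (simp add: coeff_map_poly c)
  then show ?thesis
    using subfield_setD(8)[OF K] by (auto simp: rat_eval_def split: prod.splits)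
qed

lemma geom_IMG_preserves_backward_orbit:
  "\<sigma> \<in> carrier (geom_IMG g) \<Longrightarrow> x \<in> backward_orbit g \<Longrightarrow> \<sigma> x \<in> backward_orbit g"
  using geom_IMG_preserves_preimages by (fastforce simp: backward_orbit_def)

lemma geom_IMG_rat_eval:
  assumes \<sigma>: "\<sigma> \<in> carrier (geom_IMG g)" and x: "x \<in> backward_orbit g"
  shows "\<sigma> (rat_eval closure_const r x) = rat_eval closure_const r (\<sigma> x)"
proof (rule rat_eval_hom_on[OF closure_const.field_hom_axioms subfield_set_K_infinity[of g]])
  show "range closure_const \<subseteq> K_infinity g"
    using subsetD[OF geom_base_subset_K_infinity closure_const_in_geom_base] by blast
  show "x \<in> K_infinity g"
    using x backward_orbit_subset_K_infinity by blast
qed (use \<sigma> in \<open>auto simp: geom_IMG_iff closure_const_in_geom_base\<close>)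

text \<open>The Galois correspondence makes conjugates rational in one another, and the action on
  C(x) is determined by that on x. The assumptions range over the whole backward orbit because
  rationality is also applied at the conjugates of x.\<close>

lemma commuting_orbit_bound:
  fixes g :: "'f::field poly fract"
  assumes char0: "CHAR('f) = 0" and p: "p > 0" and x: "x \<in> backward_orbit g"
    and comm: "\<And>\<sigma> \<tau> y. \<sigma> \<in> carrier (geom_IMG g) \<Longrightarrow> \<tau> \<in> carrier (geom_IMG g) \<Longrightarrow>
      y \<in> backward_orbit g \<Longrightarrow> \<sigma> (\<tau> y) = \<tau> (\<sigma> y)"
    and exponent: "\<And>\<sigma> y. \<sigma> \<in> carrier (geom_IMG g) \<Longrightarrow> y \<in> backward_orbit g \<Longrightarrow> (\<sigma> ^^ p) y = y"
  shows "finite ((\<lambda>\<sigma>. \<sigma> x) ` carrier (geom_IMG g)) \<and> card ((\<lambda>\<sigma>. \<sigma> x) ` carrier (geom_IMG g)) \<le> 2 * p"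
proof -
  note orbit = geom_IMG_preserves_backward_orbit
  note xc = backward_orbit_not_const[OF x]
  interpret X: field_hom_eval closure_const x
    using xc by (rule field_hom_eval_closure_const)
  have rational: "\<sigma> y \<in> const_adjoin y" if "\<sigma> \<in> carrier (geom_IMG g)" "y \<in> backward_orbit g" for \<sigma> y
    using geom_IMG_commuting_imp_rational[OF char0] comm that by blast
  interpret commuting_moebius closure_const "const_adjoin x" "carrier (geom_IMG g)" x p
  proof
    fix n :: nat assume "n > 0"
    then show "of_nat n \<noteq> (0 :: 'f alg_closure)"
      using char0 by (simp add: of_nat_eq_0_iff_char_dvd)
  next
    show "subfield_set (const_adjoin x)" "range closure_const \<subseteq> const_adjoin x" "x \<in> const_adjoin x"
      using const_adjoin[OF xc] by blast+
    show "x \<notin> range closure_const" "p > 0"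
      by fact+
  next
    fix \<sigma> assume \<sigma>: "\<sigma> \<in> carrier (geom_IMG g)"
    show "\<sigma> (closure_const e) = closure_const e" for e
      using \<sigma> closure_const_in_geom_base[of e] by (simp add: geom_IMG_iff)
    show "moebius_related closure_const x (\<sigma> x)"
    proof -
      interpret constant_field "closure_const :: 'f alg_closure \<Rightarrow> 'f geom"
        using char0 by unfold_locales (simp add: of_nat_eq_0_iff_char_dvd)
      obtain n where n: "n \<ge> 1" "x \<in> preimages_T n g"
        using x by (auto simp: backward_orbit_def)
      \<comment> \<open>Transitivity leads back from \<sigma> x to x, so rationality at \<sigma> x
        puts x into C(\<sigma> x); the Moebius relation needs both inclusions.\<close>
      obtain \<tau> where "\<tau> \<in> carrier (geom_IMG g)" "\<tau> (\<sigma> x) = x"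
        using geom_IMG_transitive[OF geom_IMG_preserves_preimages[OF \<sigma> n(2,1)] n(2,1)] by blast
      then have "x \<in> const_adjoin (\<sigma> x)"
        using rational[of \<tau> "\<sigma> x"] orbit[OF \<sigma> x] by simp
      moreover have "\<sigma> x \<in> const_adjoin x"
        using rational[OF \<sigma> x] .
      ultimately show ?thesis
        using mutually_rational_imp_moebius_related[OF xc backward_orbit_not_const[OF orbit[OF \<sigma> x]]]
        by blast
    qed
    have K: "u \<in> K_infinity g" if "u \<in> const_adjoin x" for u
      using that K_infinity_contains_const_adjoin[OF x] by blast
    show "\<sigma> (u + v) = \<sigma> u + \<sigma> v" "\<sigma> (u * v) = \<sigma> u * \<sigma> v"
      if "u \<in> const_adjoin x" "v \<in> const_adjoin x" for u v
      using \<sigma> K that by (simp_all add: geom_IMG_iff)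
    show "\<sigma> u \<in> const_adjoin x" if u: "u \<in> const_adjoin x" for u
    proof -
      obtain r s where "u = rat_eval closure_const r x" "\<sigma> x = rat_eval closure_const s x"
        using u rational[OF \<sigma> x] by blast
      then have "\<sigma> u = rat_eval closure_const (rat_comp r s) x"
        by (simp add: geom_IMG_rat_eval[OF \<sigma> x] X.rat_eval_rat_comp)
      then show ?thesis by blast
    qed
    show "(\<sigma> ^^ p) u = u" if u: "u \<in> const_adjoin x" for u
    proof -
      obtain r where r: "u = rat_eval closure_const r x"
        using u by blast
      have "(\<sigma> ^^ n) x \<in> backward_orbit g \<and> (\<sigma> ^^ n) u = rat_eval closure_const r ((\<sigma> ^^ n) x)" for n
        by (induction n) (simp_all add: r x orbit[OF \<sigma>] geom_IMG_rat_eval[OF \<sigma>])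
      then show ?thesis
        using exponent[OF \<sigma> x] by (simp add: r)
    qed
    fix \<tau> assume \<tau>: "\<tau> \<in> carrier (geom_IMG g)"
    show "\<sigma> (\<tau> u) = \<tau> (\<sigma> u)" if u: "u \<in> const_adjoin x" for u
    proof -
      obtain r where "u = rat_eval closure_const r x"
        using u by blast
      then show ?thesis
        using comm[OF \<sigma> \<tau> x]
        by (simp add: geom_IMG_rat_eval[OF \<sigma>] geom_IMG_rat_eval[OF \<tau>] x orbit[OF \<sigma> x] orbit[OF \<tau> x])
    qed
    show "\<exists>\<rho>\<in>carrier (geom_IMG g). \<forall>u\<in>const_adjoin x. \<rho> u = \<sigma> (\<tau> u)"
      using compose_in_geom_IMG[OF \<sigma> \<tau>] K by (intro bexI[of _ "compose (K_infinity g) \<sigma> \<tau>"]) (auto simp: compose_eq)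
  qed
  show ?thesis
    using orbit_bound by blast
qed

section \<open>Comparison of orbit sizes on the two sides\<close>

lemma CHAR_fract: "CHAR('a::idom fract) = CHAR('a)"
proof (rule CHAR_eqI)
  have of_nat: "of_nat n = (0 :: 'a fract) \<longleftrightarrow> of_nat n = (0 :: 'a)" for n
    by (simp add: of_nat_fract eq_fract Zero_fract_def)
  show "of_nat CHAR('a) = (0 :: 'a fract)"
    by (simp add: of_nat)
  show "CHAR('a) dvd n" if "of_nat n = (0 :: 'a fract)" for n
    using that by (simp add: of_nat of_nat_eq_0_iff_char_dvd)
qed

theorem theorem1p5:
  fixes p :: nat
    and f :: "'k::field poly"
    and red :: "'r::idom \<Rightarrow> 'k"
  assumes "Factorial_Ring.prime p"
    and "is_alg_closure_of_Fp p TYPE('k)"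
    and "additive_poly f"
    and "rsquarefree f"
    and "2 \<le> Polynomial.degree f"
    and "discrete_valuation_ring (ring_of_type_algebra :: 'r ring)"
    and "CHAR('r) = 0"
    and "residue_map red"
  shows "\<not> (\<exists>g :: 'r fract poly fract. geometric_IMG_lift red (frac_of f) g)"
proof
  assume "\<exists>g :: 'r fract poly fract. geometric_IMG_lift red (frac_of f) g"
  then obtain g :: "'r fract poly fract" and \<beta> where equiv: "equivalent_actions_via \<beta>
      (geom_IMG g) (\<lambda>\<sigma> \<omega>. \<sigma> \<omega>) (backward_orbit g)
      (geom_IMG (frac_of f)) (\<lambda>\<sigma> \<omega>. \<sigma> \<omega>) (backward_orbit (frac_of f))"
    unfolding geometric_IMG_lift_def Let_def by blast
  interpret additive_separable f p
  proof
    have "algebraic_closure (ring_of_type_algebra :: 'k ring) (range of_nat)"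
      using assms(2) by (simp add: is_alg_closure_of_Fp_def)
    then interpret K: algebraic_closure "ring_of_type_algebra :: 'k ring" "range of_nat" .
    show "infinite (UNIV :: 'k set)"
      using algebraically_closed_poly_root[OF K.algebraically_closed_axioms]
      by (rule infinite_if_polys_have_roots)
    show "CHAR('k) = p"
      using assms(2) by (simp add: is_alg_closure_of_Fp_def)
  qed (use assms in auto)
  obtain \<phi> where bij: "bij_betw \<beta> (backward_orbit g) (backward_orbit (frac_of f))"
    and \<phi>: "\<phi> \<in> iso (geom_IMG g) (geom_IMG (frac_of f))"
    and equivar: "\<And>\<sigma> \<omega>. \<sigma> \<in> carrier (geom_IMG g) \<Longrightarrow> \<omega> \<in> backward_orbit g \<Longrightarrow> \<beta> (\<sigma> \<omega>) = \<phi> \<sigma> (\<beta> \<omega>)"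
    using equiv by (auto simp: equivalent_actions_via_def)
  have \<phi>_bij: "bij_betw \<phi> (carrier (geom_IMG g)) (carrier (geom_IMG (frac_of f)))"
    using \<phi> by (simp add: iso_def)
  have \<phi>_in: "\<phi> \<sigma> \<in> carrier (geom_IMG (frac_of f))" if "\<sigma> \<in> carrier (geom_IMG g)" for \<sigma>
    using \<phi>_bij that by (rule bij_betwE[rule_format])
  have \<beta>_in: "\<beta> \<omega> \<in> backward_orbit (frac_of f)" if "\<omega> \<in> backward_orbit g" for \<omega>
    using bij that by (rule bij_betwE[rule_format])
  have \<beta>_inj: "\<omega> = \<omega>'" if "\<beta> \<omega> = \<beta> \<omega>'" "\<omega> \<in> backward_orbit g" "\<omega>' \<in> backward_orbit g" for \<omega> \<omega>'
    using bij that by (auto simp: bij_betw_def inj_on_def)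
  note orbit = geom_IMG_preserves_backward_orbit
  have comm: "\<sigma> (\<tau> \<omega>) = \<tau> (\<sigma> \<omega>)"
    if "\<sigma> \<in> carrier (geom_IMG g)" "\<tau> \<in> carrier (geom_IMG g)" "\<omega> \<in> backward_orbit g" for \<sigma> \<tau> \<omega>
  proof (rule \<beta>_inj)
    show "\<beta> (\<sigma> (\<tau> \<omega>)) = \<beta> (\<tau> (\<sigma> \<omega>))"
      using geom_IMG_commute[OF \<phi>_in \<phi>_in \<beta>_in] that by (simp add: equivar orbit)
  qed (use that in \<open>auto intro: orbit\<close>)
  have exponent: "(\<sigma> ^^ p) \<omega> = \<omega>" if \<sigma>: "\<sigma> \<in> carrier (geom_IMG g)" and \<omega>: "\<omega> \<in> backward_orbit g" for \<sigma> \<omega>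
  proof -
    have iter: "(\<sigma> ^^ n) \<omega> \<in> backward_orbit g \<and> \<beta> ((\<sigma> ^^ n) \<omega>) = (\<phi> \<sigma> ^^ n) (\<beta> \<omega>)" for n
      by (induction n) (simp_all add: \<sigma> \<omega> orbit equivar)
    then have "\<beta> ((\<sigma> ^^ p) \<omega>) = \<beta> \<omega>"
      using geom_IMG_exponent[OF \<phi>_in[OF \<sigma>] \<beta>_in[OF \<omega>]] by simp
    then show ?thesis
      using \<beta>_inj iter \<omega> by blast
  qed
  \<comment> \<open>One more than the bound 2 p on orbits in characteristic zero;
    \<open>preimages_large\<close> yields n points in the fibre at this level.\<close>
  define n where "n = 2 * p + 1"
  obtain A x where A: "finite A" "card A = n" "A \<subseteq> preimages_T n (frac_of f)" and x: "x \<in> preimages_T n (frac_of f)"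
    using preimages_large by blast
  have n1: "n \<ge> 1"
    by (simp add: n_def)
  then have "x \<in> backward_orbit (frac_of f)"
    using x by (auto simp: backward_orbit_def)
  then obtain \<omega> where \<omega>: "\<omega> \<in> backward_orbit g" "\<beta> \<omega> = x"
    using bij unfolding bij_betw_def by (metis imageE)
  let ?O = "(\<lambda>\<sigma>. \<sigma> \<omega>) ` carrier (geom_IMG g)"
  have "CHAR('r fract) = 0"
    using assms(7) by (simp add: CHAR_fract)
  moreover have "p > 0"
    using assms(1) by (rule prime_gt_0_nat)
  ultimately have bound: "finite ?O" "card ?O \<le> 2 * p"
    using commuting_orbit_bound \<omega>(1) comm exponent by blast+
  \<comment> \<open>The fibre of x lies in one orbit, and \<beta> carries the orbit of \<omega> onto
    that of x because \<phi> is onto.\<close>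
  have "A \<subseteq> \<beta> ` ?O"
  proof
    fix y assume "y \<in> A"
    then obtain \<psi> where \<psi>: "\<psi> \<in> carrier (geom_IMG (frac_of f))" "\<psi> x = y"
      using geom_IMG_transitive[OF x _ n1] A(3) by blast
    then obtain \<sigma> where "\<sigma> \<in> carrier (geom_IMG g)" "\<phi> \<sigma> = \<psi>"
      using \<phi>_bij unfolding bij_betw_def by (metis imageE)
    then show "y \<in> \<beta> ` ?O"
      using equivar[OF _ \<omega>(1)] \<omega>(2) \<psi>(2) by force
  qed
  then have "card A \<le> card (\<beta> ` ?O)"
    using bound(1) by (intro card_mono) auto
  also have "\<dots> \<le> card ?O"
    using bound(1) by (rule card_image_le)
  finally show False
    using bound(2) A(2) by (simp add: n_def)
qed

end
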